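(* Let $G\subseteq\mathsf{S}_\ell$ with $G\in\operatorname{Fix}(\ell^2)$. (a) If $\ell\ge3$, then one of $\alpha$, $\gamma$, $f$ is trivial on $G$; i.e. there are no counterexamples $G\subseteq\mathsf{S}_\ell$ when $\ell\ge3$. (b) Let $\ell=2$ and let $G\subseteq\mathsf{S}_2$ be a counterexample. Then either $\overline{G}=\overline{\mathsf{S}}_2\cong C_2\times D_4$ or $\overline{G}\cong D_4$. In either case, for every subgroup $H\subseteq\Gamma(2)\cap\ker(f)$, the subgroup of $\operatorname{Sp}(\mathcal{T})$ generated by $G$ and $H$ is also a counterexample. In particular, if $G$ is a maximal counterexample, then $\overline{G}\cong D_4\times C_2$ and $G\cap\Gamma(2)=\Gamma(2)\cap\ker(f)$. Moreover, there exist counterexamples $G\subseteq\mathsf{S}_2$ with $\overline{G}=\overline{\mathsf{S}}_2$, and for every subgroup $D\subseteq\overline{\mathsf{S}}_2$ isomorphic to $D_4$ there exist counterexamples $G\subseteq\mathsf{S}_2$ with $\overline{G}=D$.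
   Context: $\ell$ is a prime; $\mathcal{T}$ is a free $\mathbf{Z}_\ell$-module of rank $4$ with a nondegenerate alternating form $\langle\cdot,\cdot\rangle$; $\operatorname{Sp}(\mathcal{T})$ is its group of form-preserving automorphisms; $\pi_\ell$ is reduction mod $\ell$, $\Gamma(\ell)=\ker\pi_\ell$, $\overline{G}=\pi_\ell(G)$. $\operatorname{Fix}(\ell^2)$: subgroups $G\subseteq\operatorname{Sp}(\mathcal{T})$ with $\det(g-1)\equiv0\pmod{\ell^2}$ for all $g\in G$. A lattice is a finite-index $\mathbf{Z}_\ell$-submodule of $\mathcal{T}$; $G\in\operatorname{Fix}(\ell^2)$ is a counterexample if there are no $G$-stable lattices $\mathcal{L}'\subseteq\mathcal{L}\subseteq\mathcal{T}$ with $[\mathcal{L}:\mathcal{L}']=\ell^2$ and trivial $G$-action on $\mathcal{L}/\mathcal{L}'$; a maximal counterexample is one not properly contained in another counterexample. Fix a symplectic basis $e_1,\dots,e_4$ ($\langle e_1,e_4\rangle=\langle e_2,e_3\rangle=1$, $\langle e_1,e_2\rangle=\langle e_1,e_3\rangle=\langle e_4,e_2\rangle=\langle e_4,e_3\rangle=0$); matrices use $g(e_j)=\sum_i g_{ij}e_i$. $\mathsf{S}_\ell$: all $g\in\operatorname{Sp}(\mathcal{T})$ with $\pi_\ell(g)$ lower triangular with all diagonal entries $1$; $\overline{\mathsf{S}}_\ell=\pi_\ell(\mathsf{S}_\ell)$. For $g\in\mathsf{S}_\ell$: $\alpha(g),\gamma(g)$ are the $(2,1)$ and $(3,2)$ entries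 of $\pi_\ell(g)$; $g_{14}\in\ell\mathbf{Z}_\ell$ and $f(g)$ is the reduction mod $\ell$ of $g_{14}/\ell$; $\alpha,\gamma,f:\mathsf{S}_\ell\to\mathbf{Z}/\ell$ are homomorphisms. $D_4$ is the dihedral group of order $8$, $C_2$ the cyclic group of order $2$. *)

theory Defs
  imports
    "HOL-Analysis.Determinants"
    "HOL-Algebra.Elementary_Groups"
    "HOL-Algebra.Generated_Groups"
    "Berlekamp_Zassenhaus.Finite_Field"
begin

text \<open>
  The prime \<open>\<ell>\<close> is \<open>CARD('l)\<close> for a type \<open>'l\<close> of class \<open>prime_card\<close>, so that \<open>'l mod_ring\<close> is the
  field \<open>\<int>/\<ell>\<close>.  The ring of \<open>\<ell>\<close>-adic integers is the inverse limit of the rings \<open>\<int>/\<ell>^n\<close>: an element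
  is a sequence of compatible residues, the \<open>n\<close>-th one represented in \<open>{0..<\<ell>^n}\<close>.
\<close>

typedef ('l::prime_card) padic_int =
  "{x :: nat \<Rightarrow> int. \<forall>n. 0 \<le> x n \<and> x n < int CARD('l) ^ n \<and> x (Suc n) mod int CARD('l) ^ n = x n}"
  by (rule exI[of _ "\<lambda>_. 0"]) (auto simp: prime_gt_0_nat[OF prime_card])

setup_lifting type_definition_padic_int

lemma padic_mod_pow_Suc:
  "(a :: int) mod int CARD('l::prime_card) ^ Suc n mod int CARD('l) ^ n = a mod int CARD('l) ^ n"
  by (rule mod_mod_cancel) simp

lemma padic_mod_mem:
  assumes "a (Suc n) mod int CARD('l::prime_card) ^ n = a n mod int CARD('l) ^ n"
  shows "0 \<le> a n mod int CARD('l) ^ n \<and> a n mod int CARD('l) ^ n < int CARD('l) ^ n \<and>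
           a (Suc n) mod int CARD('l) ^ Suc n mod int CARD('l) ^ n = a n mod int CARD('l) ^ n"
proof -
  have "0 < int CARD('l) ^ n"
    by (simp add: prime_gt_0_nat[OF prime_card])
  then show ?thesis
    using assms by (simp only: padic_mod_pow_Suc) simp
qed

instantiation padic_int :: (prime_card) comm_ring_1
begin

lift_definition zero_padic_int :: "'a padic_int" is "\<lambda>_. 0"
  by (simp add: prime_gt_0_nat[OF prime_card])

lift_definition one_padic_int :: "'a padic_int" is "\<lambda>n. 1 mod int CARD('a) ^ n"
  by (rule padic_mod_mem) simp

lift_definition plus_padic_int :: "'a padic_int \<Rightarrow> 'a padic_int \<Rightarrow> 'a padic_int"
  is "\<lambda>x y n. (x n + y n) mod int CARD('a) ^ n"
  by (rule padic_mod_mem) (metis mod_add_eq)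

lift_definition uminus_padic_int :: "'a padic_int \<Rightarrow> 'a padic_int"
  is "\<lambda>x n. (- x n) mod int CARD('a) ^ n"
  by (rule padic_mod_mem) (metis mod_minus_eq)

lift_definition minus_padic_int :: "'a padic_int \<Rightarrow> 'a padic_int \<Rightarrow> 'a padic_int"
  is "\<lambda>x y n. (x n - y n) mod int CARD('a) ^ n"
  by (rule padic_mod_mem) (metis mod_diff_eq)

lift_definition times_padic_int :: "'a padic_int \<Rightarrow> 'a padic_int \<Rightarrow> 'a padic_int"
  is "\<lambda>x y n. (x n * y n) mod int CARD('a) ^ n"
  by (rule padic_mod_mem) (metis mod_mult_eq)

instance
proof
  fix a b c :: "'a padic_int"
  show "a * b * c = a * (b * c)"
    by transfer (simp add: mod_simps mult.assoc)
  show "a * b = b * a"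
    by transfer (simp add: mult.commute)
  show "1 * a = a"
    by transfer (auto simp: mod_simps)
  show "a + b + c = a + (b + c)"
    by transfer (simp add: mod_simps add.assoc)
  show "a + b = b + a"
    by transfer (simp add: add.commute)
  show "0 + a = a"
    by transfer auto
  show "- a + a = 0"
    by transfer (simp add: mod_simps)
  show "a - b = a + - b"
    by transfer (simp add: mod_simps)
  show "(a + b) * c = a * c + b * c"
    by transfer (simp add: mod_simps distrib_right)
  show "(0 :: 'a padic_int) \<noteq> 1"
  proof transfer
    have "1 < int CARD('a)"
      using prime_gt_1_nat[OF prime_card[where ?'a = 'a]] by simp
    then have "1 mod int CARD('a) ^ 1 = 1" by simp
    then show "(\<lambda>_. 0) \<noteq> (\<lambda>n. 1 mod int CARD('a) ^ n)"
      by (metis zero_neq_one)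
  qed
qed

end

lift_definition padic_residue :: "('l::prime_card) padic_int \<Rightarrow> 'l mod_ring"
  is "\<lambda>x. x 1" by (metis atLeastLessThan_iff power_one_right)

text \<open>
  Vectors are written in the fixed symplectic basis \<open>e\<^sub>1, \<dots>, e\<^sub>4\<close>, so \<open>\<T>\<close> is \<open>'l padic_int ^ 4\<close> and an
  endomorphism is the matrix \<open>g\<close> with \<open>g(e\<^sub>j) = \<Sum>\<^sub>i g\<^sub>i\<^sub>j e\<^sub>i\<close>, acting by \<open>*v\<close>.  Below, \<open>g $ i $ j\<close> is the
  \<open>(i, j)\<close> entry.  In the index type \<open>4\<close> one has \<open>4 = 0\<close>, so the order of that type is not the order
  of the indices \<open>1, 2, 3, 4\<close> and must not be used.
\<close>

definition symp_form :: "'a::comm_ring_1 ^ 4 \<Rightarrow> 'a ^ 4 \<Rightarrow> 'a" where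
  "symp_form x y = x$1 * y$4 - x$4 * y$1 + x$2 * y$3 - x$3 * y$2"

definition Sp4 :: "('a::comm_ring_1 ^ 4 ^ 4) set" where
  "Sp4 = {g. invertible g \<and> (\<forall>x y. symp_form (g *v x) (g *v y) = symp_form x y)}"

definition mat_group :: "('a::comm_ring_1 ^ 4 ^ 4) set \<Rightarrow> ('a ^ 4 ^ 4) monoid" where
  "mat_group X = \<lparr>carrier = X, monoid.mult = (**), one = mat 1\<rparr>"

definition reduce_mat :: "('l::prime_card) padic_int ^ 4 ^ 4 \<Rightarrow> 'l mod_ring ^ 4 ^ 4" where
  "reduce_mat g = (\<chi> i j. padic_residue (g $ i $ j))"

definition Gamma_ell :: "(('l::prime_card) padic_int ^ 4 ^ 4) set" where
  "Gamma_ell = {g \<in> Sp4. reduce_mat g = mat 1}"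

definition Fix_ell2 :: "(('l::prime_card) padic_int ^ 4 ^ 4) set set" where
  "Fix_ell2 = {G. subgroup G (mat_group Sp4) \<and> (\<forall>g\<in>G. of_nat (CARD('l)\<^sup>2) dvd det (g - mat 1))}"

definition cosets_in :: "'v::ab_group_add set \<Rightarrow> 'v set \<Rightarrow> 'v set set" where
  "cosets_in L L' = (\<lambda>x. (+) x ` L') ` L"

definition lattice4 :: "(('l::prime_card) padic_int ^ 4) set \<Rightarrow> bool" where
  "lattice4 L \<longleftrightarrow> module.subspace (*s) L \<and> finite (cosets_in UNIV L)"

definition stable_under :: "('a::comm_ring_1 ^ 4 ^ 4) set \<Rightarrow> ('a ^ 4) set \<Rightarrow> bool" where
  "stable_under G L \<longleftrightarrow> (\<forall>g\<in>G. \<forall>x\<in>L. g *v x \<in> L)"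

definition counterexample :: "(('l::prime_card) padic_int ^ 4 ^ 4) set \<Rightarrow> bool" where
  "counterexample G \<longleftrightarrow> G \<in> Fix_ell2 \<and>
     \<not> (\<exists>L L'. lattice4 L \<and> lattice4 L' \<and> stable_under G L \<and> stable_under G L' \<and> L' \<subseteq> L \<and>
          card (cosets_in L L') = CARD('l)\<^sup>2 \<and> (\<forall>g\<in>G. \<forall>x\<in>L. g *v x - x \<in> L'))"

definition maximal_counterexample :: "(('l::prime_card) padic_int ^ 4 ^ 4) set \<Rightarrow> bool" where
  "maximal_counterexample G \<longleftrightarrow> counterexample G \<and> \<not> (\<exists>G'. counterexample G' \<and> G \<subset> G')"

definition lower_unitriangular :: "'a::comm_ring_1 ^ 4 ^ 4 \<Rightarrow> bool" where
  "lower_unitriangular m \<longleftrightarrow> (\<forall>i. m $ i $ i = 1) \<and>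
     m $ 1 $ 2 = 0 \<and> m $ 1 $ 3 = 0 \<and> m $ 1 $ 4 = 0 \<and> m $ 2 $ 3 = 0 \<and> m $ 2 $ 4 = 0 \<and> m $ 3 $ 4 = 0"

definition S_ell :: "(('l::prime_card) padic_int ^ 4 ^ 4) set" where
  "S_ell = {g \<in> Sp4. lower_unitriangular (reduce_mat g)}"

definition alpha :: "('l::prime_card) padic_int ^ 4 ^ 4 \<Rightarrow> 'l mod_ring" where
  "alpha g = reduce_mat g $ 2 $ 1"

definition gamma :: "('l::prime_card) padic_int ^ 4 ^ 4 \<Rightarrow> 'l mod_ring" where
  "gamma g = reduce_mat g $ 3 $ 2"

text \<open>For \<open>g \<in> S_ell\<close> the quotient below exists, and it is unique because \<open>\<ell>\<close> is not a zero divisor.\<close>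

definition f_char :: "('l::prime_card) padic_int ^ 4 ^ 4 \<Rightarrow> 'l mod_ring" where
  "f_char g = padic_residue (THE c. g $ 1 $ 4 = of_nat CARD('l) * c)"

definition ker_f :: "(('l::prime_card) padic_int ^ 4 ^ 4) set" where
  "ker_f = {g \<in> S_ell. f_char g = 0}"

text \<open>
  The dihedral group of order \<open>2 n\<close>; \<open>(a, s)\<close> stands for \<open>r^a\<close> if \<open>s\<close> is false and for \<open>r^a t\<close> if \<open>s\<close> is
  true, where \<open>r\<close> is a rotation of order \<open>n\<close> and \<open>t\<close> a reflection, with \<open>t r^b = r^(-b) t\<close>.
\<close>

definition dihedral_group :: "nat \<Rightarrow> (int \<times> bool) monoid" where
  "dihedral_group n = \<lparr>carrier = {0..<int n} \<times> UNIV,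
     monoid.mult = (\<lambda>(a, s) (b, t). ((if s then a - b else a + b) mod int n, s \<noteq> t)),
     one = (0, False)\<rparr>"

abbreviation D4 :: "(int \<times> bool) monoid" where
  "D4 \<equiv> dihedral_group 4"

abbreviation C2 :: "int monoid" where
  "C2 \<equiv> integer_mod_group 2"

end

theory Submission
  imports Defs
begin

text \<open>
  The lattices \<open>M\<^sub>0 = \<T> \<supset> M\<^sub>1 \<supset> M\<^sub>2 \<supset> \<dots>\<close> with \<open>M\<^sub>1 = \<langle>\<ell>e\<^sub>1, e\<^sub>2, e\<^sub>3, e\<^sub>4\<rangle>\<close>,
  \<open>M\<^sub>2 = \<langle>\<ell>e\<^sub>1, \<ell>e\<^sub>2, e\<^sub>3, e\<^sub>4\<rangle>\<close>, \<open>M\<^sub>3 = \<langle>\<ell>e\<^sub>1, \<ell>e\<^sub>2, \<ell>e\<^sub>3, e\<^sub>4\<rangle>\<close> and \<open>M\<^sub>k\<^sub>+\<^sub>4 = \<ell>M\<^sub>k\<close> are stable under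
  \<open>S_ell\<close>.  For \<open>g \<in> S_ell\<close>, the map \<open>g - 1\<close> carries \<open>M\<^sub>k\<close> into \<open>M\<^sub>k\<^sub>+\<^sub>1\<close> and induces
  \<open>M\<^sub>k / M\<^sub>k\<^sub>+\<^sub>1 \<rightarrow> M\<^sub>k\<^sub>+\<^sub>1 / M\<^sub>k\<^sub>+\<^sub>2\<close>, which is multiplication by \<open>\<alpha>, \<gamma>, -\<alpha>, f\<close> for \<open>k \<equiv> 0, 1, 2, 3\<close>
  modulo 4.  If one character vanishes on \<open>G\<close>, then \<open>G\<close> acts trivially on some \<open>M\<^sub>k / M\<^sub>k\<^sub>+\<^sub>2\<close>.  If none
  vanishes and \<open>G\<close> acts trivially on \<open>L / L'\<close>, take the largest \<open>k\<close> with \<open>L \<subseteq> M\<^sub>k\<close>; applying \<open>g - 1\<close>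
  repeatedly gives elements of \<open>L'\<close> in every \<open>M\<^sub>j - M\<^sub>j\<^sub>+\<^sub>1\<close> with \<open>j > k\<close>, so \<open>M\<^sub>k\<^sub>+\<^sub>1 \<subseteq> L' \<subseteq> L \<subseteq> M\<^sub>k\<close> and
  \<open>[L : L'] \<le> \<ell>\<close>.

  Since \<open>det (g - 1) \<equiv> \<ell> \<alpha>\<^sup>2 \<gamma> f\<close> modulo \<open>\<ell>\<^sup>2\<close>, the counterexamples are therefore the subgroups on which
  \<open>\<alpha> \<gamma> f\<close> vanishes pointwise but none of the three homomorphisms vanishes identically.  For \<open>\<ell> \<ge> 3\<close>
  there are none, and for \<open>\<ell> = 2\<close> the image of \<open>(\<alpha>, \<gamma>, f)\<close> must be the plane \<open>f = \<alpha> + \<gamma>\<close>.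
\<close>

type_synonym 'l pmat = "'l padic_int ^ 4 ^ 4"

section \<open>Arithmetic of the \<open>\<ell>\<close>-adic integers\<close>

lemma int_card_gt_1: "1 < int CARD('l::prime_card)"
  using prime_gt_1_nat[OF prime_card[where ?'a = 'l]] by simp

lemma int_card_pos: "0 < int CARD('l::prime_card)"
  using int_card_gt_1[where 'l = 'l] by linarith

lemma Rep_padic_range:
  "0 \<le> Rep_padic_int (x :: 'l::prime_card padic_int) n"
  "Rep_padic_int x n < int CARD('l) ^ n"
  using Rep_padic_int[of x] by auto

lemma Rep_padic_mod:
  "n \<le> m \<Longrightarrow> Rep_padic_int (x :: 'l::prime_card padic_int) m mod int CARD('l) ^ n = Rep_padic_int x n"
proof (induction m rule: dec_induct)
  case base
  then show ?case by (simp add: Rep_padic_range)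
next
  case (step m)
  have "Rep_padic_int x (Suc m) mod int CARD('l) ^ m = Rep_padic_int x m"
    using Rep_padic_int[of x] by auto
  then have "Rep_padic_int x (Suc m) mod int CARD('l) ^ m mod int CARD('l) ^ n = Rep_padic_int x n"
    using step.IH by simp
  then show ?case
    using step.hyps by (simp add: mod_mod_cancel le_imp_power_dvd)
qed

lemma padic_eqI: "(\<And>n. Rep_padic_int x n = Rep_padic_int y n) \<Longrightarrow> x = y"
  by (metis Rep_padic_int_inject ext)

lemma Rep_padic_of_nat:
  "Rep_padic_int (of_nat k :: 'l::prime_card padic_int) n = int k mod int CARD('l) ^ n"
proof (induction k)
  case 0
  then show ?case by (simp add: zero_padic_int.rep_eq)
next
  case (Suc k)
  then show ?case
    by (simp add: plus_padic_int.rep_eq one_padic_int.rep_eq mod_simps)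
qed

lemma Rep_padic_prime_power_mult:
  "Rep_padic_int (of_nat CARD('l) ^ k * x :: 'l::prime_card padic_int) n
     = (int CARD('l) ^ k * Rep_padic_int x n) mod int CARD('l) ^ n"
proof -
  have "Rep_padic_int (of_nat (CARD('l) ^ k) * x :: 'l padic_int) n
     = (int CARD('l) ^ k * Rep_padic_int x n) mod int CARD('l) ^ n"
    by (simp only: times_padic_int.rep_eq Rep_padic_of_nat mod_mult_left_eq) simp
  then show ?thesis by simp
qed

text \<open>Division by \<ell> shifts the residues: residue \<open>n\<close> of the quotient is
  residue \<open>Suc n\<close> of \<open>x\<close> divided by \<ell>, which is exact because every
  residue of \<open>x\<close> is divisible by \<ell>.\<close>

lemma padic_prime_dvd:
  assumes "Rep_padic_int (x :: 'l::prime_card padic_int) 1 = 0"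
  shows "of_nat CARD('l) dvd x"
proof -
  define p where "p = int CARD('l)"
  define f where "f n = Rep_padic_int x (Suc n) div p" for n
  have p: "0 < p" unfolding p_def by (rule int_card_pos)
  have mem: "0 \<le> f n \<and> f n < p ^ n \<and> f (Suc n) mod p ^ n = f n" for n
  proof (intro conjI)
    show "0 \<le> f n"
      using p by (simp add: f_def Rep_padic_range pos_imp_zdiv_nonneg_iff)
    have "Rep_padic_int x (Suc n) < p ^ n * p"
      using Rep_padic_range(2)[of x "Suc n"] by (simp add: p_def mult.commute)
    then show "f n < p ^ n"
    proof (rule contrapos_pp)
      assume "\<not> f n < p ^ n"
      then have "p ^ n * p \<le> f n * p" using p by simp
      also have "\<dots> \<le> Rep_padic_int x (Suc n)"
        unfolding f_def using Rep_padic_range(1)[of x "Suc n"] p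
        by (simp add: minus_mod_eq_div_mult[symmetric])
      finally show "\<not> Rep_padic_int x (Suc n) < p ^ n * p" by simp
    qed
    have "Rep_padic_int x (Suc n) = Rep_padic_int x (Suc (Suc n)) mod (p * p ^ n)"
      using Rep_padic_mod[of "Suc n" "Suc (Suc n)" x] by (simp add: p_def)
    also have "\<dots> = p * (f (Suc n) mod p ^ n) + Rep_padic_int x (Suc (Suc n)) mod p"
      using p by (simp add: f_def zmod_zmult2_eq)
    finally show "f (Suc n) mod p ^ n = f n"
      using p by (simp add: f_def)
  qed
  define y where "y = (Abs_padic_int f :: 'l padic_int)"
  have y: "Rep_padic_int y = f"
    unfolding y_def by (rule Abs_padic_int_inverse) (use mem in \<open>auto simp: p_def\<close>)
  have "Rep_padic_int (of_nat CARD('l) * y) n = Rep_padic_int x n" for n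
  proof -
    have "Rep_padic_int x (Suc n) mod p = 0"
      using Rep_padic_mod[of 1 "Suc n" x] assms by (simp add: p_def)
    then have "p * f n = Rep_padic_int x (Suc n)"
      by (auto simp: f_def)
    then show ?thesis
      using Rep_padic_mod[of n "Suc n" x]
        Rep_padic_prime_power_mult[where 'l = 'l and k = 1 and x = y and n = n]
      by (simp add: y p_def)
  qed
  then have "of_nat CARD('l) * y = x"
    by (intro padic_eqI) simp
  then show ?thesis by (metis dvd_triv_left)
qed

text \<open>Cancelling \<ell> costs one level, from \<ell>^(n+1) to \<ell>^n; this suffices because
  \<open>n\<close> is arbitrary.\<close>

lemma padic_prime_mult_eq_0:
  assumes "of_nat CARD('l) * (x :: 'l::prime_card padic_int) = 0"
  shows "x = 0"
proof (rule padic_eqI)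
  fix n
  have "int CARD('l) ^ Suc n dvd int CARD('l) * Rep_padic_int x (Suc n)"
    using Rep_padic_prime_power_mult[where k = 1 and x = x and n = "Suc n"] assms
    by (simp add: zero_padic_int.rep_eq mod_0_imp_dvd)
  then have "int CARD('l) ^ n dvd Rep_padic_int x (Suc n)"
    using int_card_pos[where 'l = 'l] by simp
  then show "Rep_padic_int x n = Rep_padic_int 0 n"
    using Rep_padic_mod[of n "Suc n" x] by (simp add: zero_padic_int.rep_eq)
qed

lemma padic_prime_mult_cancel:
  "of_nat CARD('l) * (x :: 'l::prime_card padic_int) = of_nat CARD('l) * y \<longleftrightarrow> x = y"
proof
  assume "of_nat CARD('l) * x = of_nat CARD('l) * y"
  then have "of_nat CARD('l) * (x - y) = 0"
    by (simp add: right_diff_distrib)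
  from padic_prime_mult_eq_0[OF this] show "x = y" by simp
qed simp

lemma padic_mult_dvd_mult:
  "of_nat CARD('l) * (x :: 'l::prime_card padic_int) dvd of_nat CARD('l) * y \<longleftrightarrow> x dvd y"
  by (auto simp: dvd_def mult.assoc padic_prime_mult_cancel)

text \<open>The inverse is the geometric series in \<ell>^d, cut off after \<open>n\<close> terms at
  level \<open>n\<close>; the omitted terms vanish modulo \<ell>^n since \<open>d\<close> is
  positive.\<close>

lemma padic_one_minus_prime_power_unit:
  assumes "0 < d"
  shows "(1 - of_nat CARD('l) ^ d :: 'l::prime_card padic_int) dvd 1"
proof -
  define p where "p = int CARD('l)"
  define f where "f n = (\<Sum>k<n. (p ^ d) ^ k) mod p ^ n" for n
  have p: "0 < p" unfolding p_def by (rule int_card_pos)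
  have pn: "(p ^ d) ^ n mod p ^ n = 0" for n
    using assms by (simp add: le_imp_power_dvd flip: power_mult)
  have mem: "0 \<le> f n \<and> f n < p ^ n \<and> f (Suc n) mod p ^ n = f n" for n
  proof -
    have "f (Suc n) mod p ^ n = ((\<Sum>k<n. (p ^ d) ^ k) + (p ^ d) ^ n) mod p ^ n"
      unfolding f_def by (subst mod_mod_cancel) (simp_all add: p_def)
    also have "\<dots> = f n"
      using pn[of n] by (metis add.right_neutral f_def mod_add_right_eq)
    finally show ?thesis
      using p by (simp add: f_def)
  qed
  define y where "y = (Abs_padic_int f :: 'l padic_int)"
  have y: "Rep_padic_int y = f"
    unfolding y_def by (rule Abs_padic_int_inverse) (use mem in \<open>auto simp: p_def\<close>)
  have "Rep_padic_int ((1 - of_nat CARD('l) ^ d) * y) n = Rep_padic_int (1 :: 'l padic_int) n" for n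
  proof -
    have "Rep_padic_int (1 - of_nat CARD('l) ^ d :: 'l padic_int) n = (1 - p ^ d) mod p ^ n"
      using Rep_padic_of_nat[where 'l = 'l and k = "CARD('l) ^ d" and n = n]
      by (simp add: minus_padic_int.rep_eq one_padic_int.rep_eq p_def mod_diff_eq)
    then have "Rep_padic_int ((1 - of_nat CARD('l) ^ d) * y) n
      = ((1 - p ^ d) * (\<Sum>k<n. (p ^ d) ^ k)) mod p ^ n"
      by (simp add: times_padic_int.rep_eq y f_def mod_mult_eq p_def)
    also have "(1 - p ^ d) * (\<Sum>k<n. (p ^ d) ^ k) = 1 - (p ^ d) ^ n"
      by (simp add: one_diff_power_eq)
    also have "\<dots> mod p ^ n = 1 mod p ^ n"
      using pn[of n] by (metis diff_zero mod_diff_right_eq)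
    finally show ?thesis
      by (simp add: one_padic_int.rep_eq p_def)
  qed
  then have "(1 - of_nat CARD('l) ^ d) * y = 1"
    by (intro padic_eqI) simp
  then show ?thesis by (metis dvd_triv_left)
qed

section \<open>Reduction to the residue field as a ring homomorphism\<close>

lemma padic_residue_conv:
  "padic_residue (x :: 'l::prime_card padic_int) = of_int_mod_ring (Rep_padic_int x 1)"
proof -
  have "Rep_padic_int x 1 mod int CARD('l) = Rep_padic_int x 1"
    using Rep_padic_range[of x 1] by simp
  then show ?thesis
    unfolding of_int_mod_ring_def padic_residue_def by simp
qed

lemma of_int_mod_ring_mod_card [simp]:
  "of_int_mod_ring (a mod int CARD('l)) = (of_int_mod_ring a :: 'l::prime_card mod_ring)"
  by transfer simp

lemma padic_residue_0 [simp]: "padic_residue 0 = 0"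
  by (simp add: padic_residue_conv zero_padic_int.rep_eq)

lemma padic_residue_1 [simp]: "padic_residue 1 = 1"
  by (simp add: padic_residue_conv one_padic_int.rep_eq flip: of_int_of_int_mod_ring)

lemma padic_residue_add [simp]: "padic_residue (x + y) = padic_residue x + padic_residue y"
  by (simp add: padic_residue_conv plus_padic_int.rep_eq) (simp flip: of_int_of_int_mod_ring)

lemma padic_residue_mult [simp]: "padic_residue (x * y) = padic_residue x * padic_residue y"
  by (simp add: padic_residue_conv times_padic_int.rep_eq) (simp flip: of_int_of_int_mod_ring)

lemma padic_residue_minus [simp]: "padic_residue (- x) = - padic_residue x"
  by (simp add: padic_residue_conv uminus_padic_int.rep_eq) (simp flip: of_int_of_int_mod_ring)

lemma padic_residue_diff [simp]: "padic_residue (x - y) = padic_residue x - padic_residue y"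
  by (metis add_uminus_conv_diff padic_residue_add padic_residue_minus)

lemma padic_residue_of_nat [simp]: "padic_residue (of_nat n) = of_nat n"
  by (induction n) auto

lemma padic_residue_eq_0_iff:
  "padic_residue (x :: 'l::prime_card padic_int) = 0 \<longleftrightarrow> of_nat CARD('l) dvd x"
proof
  assume "padic_residue x = 0"
  then have "Rep_padic_int x 1 = 0"
    by (metis Rep_padic_range of_int_mod_ring_hom.hom_zero padic_residue_conv power_one_right
        to_int_mod_ring_of_int_mod_ring zero_mod_ring.rep_eq to_int_mod_ring.rep_eq)
  then show "of_nat CARD('l) dvd x" by (rule padic_prime_dvd)
qed (auto elim!: dvdE)

lemma padic_residue_surj: "\<exists>k<CARD('l). (a :: 'l::prime_card mod_ring) = padic_residue (of_nat k)"
  using surj_of_nat_mod_ring[of a] by simp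

section \<open>Symplectic matrices and their characters\<close>

lemma det_4:
  "det (A :: 'a::comm_ring_1^4^4) =
     A$1$1 * A$2$2 * A$3$3 * A$4$4 - A$1$1 * A$2$2 * A$3$4 * A$4$3 - A$1$1 * A$2$3 * A$3$2 * A$4$4 +
     A$1$1 * A$2$3 * A$3$4 * A$4$2 + A$1$1 * A$2$4 * A$3$2 * A$4$3 - A$1$1 * A$2$4 * A$3$3 * A$4$2 -
     A$1$2 * A$2$1 * A$3$3 * A$4$4 + A$1$2 * A$2$1 * A$3$4 * A$4$3 + A$1$2 * A$2$3 * A$3$1 * A$4$4 -
     A$1$2 * A$2$3 * A$3$4 * A$4$1 - A$1$2 * A$2$4 * A$3$1 * A$4$3 + A$1$2 * A$2$4 * A$3$3 * A$4$1 +
     A$1$3 * A$2$1 * A$3$2 * A$4$4 - A$1$3 * A$2$1 * A$3$4 * A$4$2 - A$1$3 * A$2$2 * A$3$1 * A$4$4 +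
     A$1$3 * A$2$2 * A$3$4 * A$4$1 + A$1$3 * A$2$4 * A$3$1 * A$4$2 - A$1$3 * A$2$4 * A$3$2 * A$4$1 -
     A$1$4 * A$2$1 * A$3$2 * A$4$3 + A$1$4 * A$2$1 * A$3$3 * A$4$2 + A$1$4 * A$2$2 * A$3$1 * A$4$3 -
     A$1$4 * A$2$2 * A$3$3 * A$4$1 - A$1$4 * A$2$3 * A$3$1 * A$4$2 + A$1$4 * A$2$3 * A$3$2 * A$4$1"
proof -
  have f: "finite {2::4, 3, 4}" "1 \<notin> {2::4, 3, 4}" "finite {3::4, 4}" "2 \<notin> {3::4, 4}"
      "finite {4::4}" "3 \<notin> {4::4}"
    by auto
  show ?thesis
    unfolding det_def UNIV_4
    unfolding sum_over_permutations_insert[OF f(1,2)]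
    unfolding sum_over_permutations_insert[OF f(3,4)]
    unfolding sum_over_permutations_insert[OF f(5,6)]
    unfolding permutes_sing
    by (simp add: sign_swap_id permutation_swap_id permutation_compose sign_compose sign_id
        swap_id_eq transpose_def algebra_simps)
qed

lemma matrix_mult_nth_4:
  "((A :: 'a::comm_ring_1^4^4) ** B) $ i $ j =
     A$i$1 * B$1$j + A$i$2 * B$2$j + A$i$3 * B$3$j + A$i$4 * B$4$j"
  by (simp add: matrix_matrix_mult_def sum_4)

lemma matrix_vector_mult_nth_4:
  "((A :: 'a::comm_ring_1^4^4) *v x) $ i = A$i$1 * x$1 + A$i$2 * x$2 + A$i$3 * x$3 + A$i$4 * x$4"
  by (simp add: matrix_vector_mult_def sum_4)

lemma mat_1_nth: "(mat 1 :: 'a::comm_ring_1^'n^'n) $ i $ j = (if i = j then 1 else 0)"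
  by (simp add: mat_def)

lemma mat_group_simps [simp]:
  "carrier (mat_group X) = X"
  "x \<otimes>\<^bsub>mat_group X\<^esub> y = x ** y"
  "\<one>\<^bsub>mat_group X\<^esub> = mat 1"
  by (simp_all add: mat_group_def)

lemma Sp4_one [simp]: "mat 1 \<in> Sp4"
  by (auto simp: Sp4_def invertible_def intro!: exI[of _ "mat 1"])

lemma Sp4_mult: "g \<in> Sp4 \<Longrightarrow> h \<in> Sp4 \<Longrightarrow> g ** h \<in> Sp4"
  by (auto simp: Sp4_def invertible_mult simp flip: matrix_vector_mul_assoc)

lemma Sp4_inverse:
  assumes "g \<in> Sp4"
  obtains h where "h \<in> Sp4" "g ** h = mat 1" "h ** g = mat 1"
proof -
  from assms obtain h where h: "g ** h = mat 1" "h ** g = mat 1"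
    by (auto simp: Sp4_def invertible_def)
  have "symp_form (h *v x) (h *v y) = symp_form x y" for x y
  proof -
    have "symp_form (g *v (h *v x)) (g *v (h *v y)) = symp_form (h *v x) (h *v y)"
      using assms by (simp add: Sp4_def)
    then show ?thesis by (simp add: matrix_vector_mul_assoc h)
  qed
  with h have "h \<in> Sp4" by (auto simp: Sp4_def invertible_def)
  with h that show thesis by blast
qed

lemma group_Sp4: "group (mat_group Sp4)"
proof (rule groupI)
  fix x y z :: "'a^4^4"
  assume "x \<in> carrier (mat_group Sp4)"
  then show "\<exists>y\<in>carrier (mat_group Sp4). y \<otimes>\<^bsub>mat_group Sp4\<^esub> x = \<one>\<^bsub>mat_group Sp4\<^esub>"
    by (metis Sp4_inverse mat_group_simps)
qed (auto simp: Sp4_mult matrix_mul_assoc)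

text \<open>The inverse enters through the equation \<open>g ** h = mat 1\<close>, so that
  reductions and characters can be applied to it directly.\<close>

lemma subgroup_Sp4I:
  assumes "X \<subseteq> Sp4" "mat 1 \<in> X" "\<And>g h. g \<in> X \<Longrightarrow> h \<in> X \<Longrightarrow> g ** h \<in> X"
    "\<And>g h. g \<in> X \<Longrightarrow> h \<in> Sp4 \<Longrightarrow> g ** h = mat 1 \<Longrightarrow> h \<in> X"
  shows "subgroup X (mat_group Sp4)"
proof -
  interpret group "mat_group (Sp4 :: ('a^4^4) set)" by (rule group_Sp4)
  show ?thesis
  proof (rule subgroupI)
    fix g assume g: "g \<in> X"
    then have "inv\<^bsub>mat_group Sp4\<^esub> g \<in> Sp4" "g ** inv\<^bsub>mat_group Sp4\<^esub> g = mat 1"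
      using inv_closed[of g] r_inv[of g] assms(1) by auto
    then show "inv\<^bsub>mat_group Sp4\<^esub> g \<in> X" using assms(4) g by blast
  qed (use assms in auto)
qed

lemma symp_form_axis:
  "symp_form ((g :: 'a::comm_ring_1^4^4) *v axis i 1) (g *v axis j 1) =
     g$1$i * g$4$j - g$4$i * g$1$j + g$2$i * g$3$j - g$3$i * g$2$j"
proof -
  have "(g *v axis k 1) $ m = g $ m $ k" for k m
    by (simp add: matrix_vector_mult_def axis_def if_distrib cong: if_cong)
  then show ?thesis by (simp add: symp_form_def)
qed

text \<open>Preservation of the form on the pairs (e1, e2) and (e1, e3). Modulo \<ell> these
  relations yield the entries (3,1) and (4,3) of a matrix in \<open>S_ell\<close>.\<close>

lemma Sp4_columns:
  assumes "g \<in> Sp4"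
  shows "g$1$1 * g$4$2 - g$4$1 * g$1$2 + g$2$1 * g$3$2 - g$3$1 * g$2$2 = 0"
    and "g$1$1 * g$4$3 - g$4$1 * g$1$3 + g$2$1 * g$3$3 - g$3$1 * g$2$3 = 0"
proof -
  have *: "symp_form (g *v axis i 1) (g *v axis j 1) = symp_form (axis i 1) (axis j 1)" for i j
    using assms by (simp add: Sp4_def)
  show "g$1$1 * g$4$2 - g$4$1 * g$1$2 + g$2$1 * g$3$2 - g$3$1 * g$2$2 = 0"
    using *[of 1 2] unfolding symp_form_axis by (simp add: symp_form_def axis_def)
  show "g$1$1 * g$4$3 - g$4$1 * g$1$3 + g$2$1 * g$3$3 - g$3$1 * g$2$3 = 0"
    using *[of 1 3] unfolding symp_form_axis by (simp add: symp_form_def axis_def)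
qed

lemma lower_unitriangular_simps:
  assumes "lower_unitriangular m"
  shows "m$1$1 = 1" "m$2$2 = 1" "m$3$3 = 1" "m$4$4 = 1" "m$1$2 = 0" "m$1$3 = 0" "m$1$4 = 0"
    "m$2$3 = 0" "m$2$4 = 0" "m$3$4 = 0"
  using assms by (auto simp: lower_unitriangular_def)

lemma lower_unitriangular_mat_1: "lower_unitriangular (mat 1)"
  by (simp add: lower_unitriangular_def mat_1_nth)

lemma lower_unitriangular_mult:
  assumes "lower_unitriangular a" "lower_unitriangular b"
  shows "lower_unitriangular (a ** b)"
  unfolding lower_unitriangular_def forall_4
  by (simp add: matrix_mult_nth_4 assms[THEN lower_unitriangular_simps(1)]
      lower_unitriangular_simps[OF assms(1)] lower_unitriangular_simps[OF assms(2)])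

text \<open>Forward substitution: row i of the product is row i of \<open>b\<close> plus multiples
  of earlier rows, so \<open>b\<close> is determined from the top row downwards.\<close>

lemma lower_unitriangular_right_inverse:
  assumes "lower_unitriangular a" "a ** b = mat 1"
  shows "lower_unitriangular b"
proof -
  have eq: "a$i$1 * b$1$j + a$i$2 * b$2$j + a$i$3 * b$3$j + a$i$4 * b$4$j = (if i = j then 1 else 0)" for i j
    using assms(2) by (metis matrix_mult_nth_4 mat_1_nth)
  note a = lower_unitriangular_simps[OF assms(1)]
  have 1: "b$1$1 = 1" "b$1$2 = 0" "b$1$3 = 0" "b$1$4 = 0"
    using eq[of 1] by (simp_all add: a)
  have 2: "b$2$2 = 1" "b$2$3 = 0" "b$2$4 = 0"
    using eq[of 2 2] eq[of 2 3] eq[of 2 4] by (simp_all add: a 1)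
  have 3: "b$3$3 = 1" "b$3$4 = 0"
    using eq[of 3 3] eq[of 3 4] by (simp_all add: a 1 2)
  have 4: "b$4$4 = 1"
    using eq[of 4 4] by (simp add: a 1 2 3)
  show ?thesis
    unfolding lower_unitriangular_def forall_4 by (simp add: 1 2 3 4)
qed

lemma reduce_mat_nth [simp]: "reduce_mat g $ i $ j = padic_residue (g $ i $ j)"
  by (simp add: reduce_mat_def)

lemma reduce_mat_1 [simp]: "reduce_mat (mat 1) = mat 1"
  by (simp add: vec_eq_iff mat_1_nth)

lemma reduce_mat_mult: "reduce_mat (g ** h) = reduce_mat g ** reduce_mat h"
  by (simp add: vec_eq_iff matrix_mult_nth_4)

lemma S_ell_one [simp]: "mat 1 \<in> S_ell"
  by (simp add: S_ell_def lower_unitriangular_mat_1)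

lemma S_ell_mult: "g \<in> S_ell \<Longrightarrow> h \<in> S_ell \<Longrightarrow> g ** h \<in> S_ell"
  by (simp add: S_ell_def Sp4_mult reduce_mat_mult lower_unitriangular_mult)

lemma S_ell_right_inverse: "g \<in> S_ell \<Longrightarrow> h \<in> Sp4 \<Longrightarrow> g ** h = mat 1 \<Longrightarrow> h \<in> S_ell"
  unfolding S_ell_def
  by (metis (mono_tags, lifting) lower_unitriangular_right_inverse mem_Collect_eq reduce_mat_1 reduce_mat_mult)

lemma S_ell_residue:
  assumes "g \<in> S_ell"
  shows "padic_residue (g$1$1) = 1" "padic_residue (g$2$2) = 1" "padic_residue (g$3$3) = 1"
    "padic_residue (g$4$4) = 1" "padic_residue (g$1$2) = 0" "padic_residue (g$1$3) = 0"
    "padic_residue (g$1$4) = 0" "padic_residue (g$2$3) = 0" "padic_residue (g$2$4) = 0"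
    "padic_residue (g$3$4) = 0" "padic_residue (g$2$1) = alpha g" "padic_residue (g$3$2) = gamma g"
    "padic_residue (g$4$3) = - alpha g"
    "padic_residue (g$3$1) = padic_residue (g$4$2) + alpha g * gamma g"
proof -
  have g: "g \<in> Sp4" "lower_unitriangular (reduce_mat g)"
    using assms by (auto simp: S_ell_def)
  show r: "padic_residue (g$1$1) = 1" "padic_residue (g$2$2) = 1" "padic_residue (g$3$3) = 1"
    "padic_residue (g$4$4) = 1" "padic_residue (g$1$2) = 0" "padic_residue (g$1$3) = 0"
    "padic_residue (g$1$4) = 0" "padic_residue (g$2$3) = 0" "padic_residue (g$2$4) = 0"
    "padic_residue (g$3$4) = 0"
    using lower_unitriangular_simps[OF g(2)] by simp_all
  show a: "padic_residue (g$2$1) = alpha g" "padic_residue (g$3$2) = gamma g"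
    by (simp_all add: alpha_def gamma_def)
  have "padic_residue (g$4$3) + alpha g = 0"
    using arg_cong[OF Sp4_columns(2)[OF g(1)], of padic_residue] by (simp add: r a)
  then show "padic_residue (g$4$3) = - alpha g"
    by (simp add: eq_neg_iff_add_eq_0)
  have "padic_residue (g$4$2) + alpha g * gamma g - padic_residue (g$3$1) = 0"
    using arg_cong[OF Sp4_columns(1)[OF g(1)], of padic_residue] by (simp add: r a)
  then show "padic_residue (g$3$1) = padic_residue (g$4$2) + alpha g * gamma g"
    by simp
qed

lemma f_char_eqI: "g $ 1 $ 4 = of_nat CARD('l) * c \<Longrightarrow> f_char (g :: 'l::prime_card pmat) = padic_residue c"
  unfolding f_char_def by (simp add: padic_prime_mult_cancel)

lemma S_ell_f_char:
  assumes "(g :: 'l::prime_card pmat) \<in> S_ell"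
  obtains c where "g $ 1 $ 4 = of_nat CARD('l) * c" "f_char g = padic_residue c"
  using S_ell_residue(7)[OF assms] f_char_eqI[of g]
  by (auto simp: padic_residue_eq_0_iff elim!: dvdE)

lemma alpha_mult: "g \<in> S_ell \<Longrightarrow> h \<in> S_ell \<Longrightarrow> alpha (g ** h) = alpha g + alpha h"
  by (simp add: alpha_def matrix_mult_nth_4) (simp add: S_ell_residue)

lemma gamma_mult: "g \<in> S_ell \<Longrightarrow> h \<in> S_ell \<Longrightarrow> gamma (g ** h) = gamma g + gamma h"
  by (simp add: gamma_def matrix_mult_nth_4) (simp add: S_ell_residue)

text \<open>In the (1,4) entry of the product the two middle summands are products of two entries
  divisible by \<ell>, so they disappear modulo \<ell>^2.\<close>

lemma f_char_mult:
  assumes g: "(g :: 'l::prime_card pmat) \<in> S_ell" and h: "h \<in> S_ell"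
  shows "f_char (g ** h) = f_char g + f_char h"
proof -
  let ?p = "of_nat CARD('l) :: 'l padic_int"
  obtain c where c: "g $ 1 $ 4 = ?p * c" "f_char g = padic_residue c"
    using S_ell_f_char[OF g] .
  obtain d where d: "h $ 1 $ 4 = ?p * d" "f_char h = padic_residue d"
    using S_ell_f_char[OF h] .
  obtain a b where ab: "g $ 1 $ 2 = ?p * a" "g $ 1 $ 3 = ?p * b"
    using S_ell_residue(5,6)[OF g] by (auto simp: padic_residue_eq_0_iff elim!: dvdE)
  have "(g ** h) $ 1 $ 4 = ?p * (g$1$1 * d + a * h$2$4 + b * h$3$4 + c * h$4$4)"
    by (simp add: matrix_mult_nth_4 ab c d algebra_simps)
  from f_char_eqI[OF this] show ?thesis
    by (simp add: c d S_ell_residue[OF g] S_ell_residue[OF h])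
qed

lemma characters_mat_1 [simp]: "alpha (mat 1) = 0" "gamma (mat 1) = 0" "f_char (mat 1) = 0"
  by (simp_all add: alpha_def gamma_def mat_1_nth f_char_eqI[where c = 0])

text \<open>
  Modulo \<open>\<ell>\<^sup>2\<close> the determinant is the single term through the entries (1,4), (2,1), (3,2), (4,3): every
  other permutation meets the diagonal or the part above it at least twice.
\<close>

lemma det_minus_1_dvd_iff:
  assumes g: "(g :: 'l::prime_card pmat) \<in> S_ell"
  shows "of_nat (CARD('l)\<^sup>2) dvd det (g - mat 1) \<longleftrightarrow> alpha g * gamma g * f_char g = 0"
proof -
  let ?p = "of_nat CARD('l) :: 'l padic_int"
  let ?m = "g - mat 1"
  note r = S_ell_residue[OF g]
  have m: "padic_residue (?m $ i $ j) = padic_residue (g $ i $ j) - (if i = j then 1 else 0)" for i j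
    by (simp add: mat_1_nth)
  have ex: "padic_residue x = 0 \<Longrightarrow> \<exists>c. x = ?p * c" for x :: "'l padic_int"
    by (auto simp: padic_residue_eq_0_iff elim!: dvdE)
  have "\<exists>c. ?m$1$1 = ?p * c" "\<exists>c. ?m$2$2 = ?p * c" "\<exists>c. ?m$3$3 = ?p * c" "\<exists>c. ?m$4$4 = ?p * c"
    "\<exists>c. ?m$1$2 = ?p * c" "\<exists>c. ?m$1$3 = ?p * c" "\<exists>c. ?m$2$3 = ?p * c"
    "\<exists>c. ?m$2$4 = ?p * c" "\<exists>c. ?m$3$4 = ?p * c"
    by (rule ex, simp only: m r, simp)+
  then obtain a11 a22 a33 a44 a12 a13 a23 a24 a34 where a:
    "?m$1$1 = ?p * a11" "?m$2$2 = ?p * a22" "?m$3$3 = ?p * a33" "?m$4$4 = ?p * a44"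
    "?m$1$2 = ?p * a12" "?m$1$3 = ?p * a13" "?m$2$3 = ?p * a23" "?m$2$4 = ?p * a24" "?m$3$4 = ?p * a34"
    by blast
  obtain c where c: "g$1$4 = ?p * c" "f_char g = padic_residue c"
    using S_ell_f_char[OF g] .
  have m14: "?m$1$4 = ?p * c" by (simp add: c mat_1_nth)
  \<comment> \<open>The 4-cycle has sign -1, so adding its term cancels it. The witness lists the
    other 23 terms of \<open>det_4\<close>, each divided by \<ell>^2.\<close>
  have "?p\<^sup>2 dvd det ?m + ?p * (c * ?m$2$1 * ?m$3$2 * ?m$4$3)"
    unfolding det_4 a m14
    by (rule dvdI[of _ _ "?p * ?p * a11 * a22 * a33 * a44 - ?p * a11 * a22 * a34 * ?m$4$3 - ?p * a11 * a23 * a44 *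
      ?m$3$2 + ?p * a11 * a23 * a34 * ?m$4$2 + a11 * a24 * ?m$3$2 * ?m$4$3 - ?p * a11 * a24 * a33
      * ?m$4$2 - ?p * a12 * a33 * a44 * ?m$2$1 + a12 * a34 * ?m$2$1 * ?m$4$3 + ?p * a12 * a23 *
      a44 * ?m$3$1 - ?p * a12 * a23 * a34 * ?m$4$1 - a12 * a24 * ?m$3$1 * ?m$4$3 + ?p * a12 * a24
      * a33 * ?m$4$1 + a13 * a44 * ?m$2$1 * ?m$3$2 - a13 * a34 * ?m$2$1 * ?m$4$2 - ?p * a13 * a22
      * a44 * ?m$3$1 + ?p * a13 * a22 * a34 * ?m$4$1 + a13 * a24 * ?m$3$1 * ?m$4$2 - a13 * a24 *
      ?m$3$2 * ?m$4$1 + c * a33 * ?m$2$1 * ?m$4$2 + c * a22 * ?m$3$1 * ?m$4$3 - ?p * c * a22 * a33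
      * ?m$4$1 - c * a23 * ?m$3$1 * ?m$4$2 + c * a23 * ?m$3$2 * ?m$4$1"]) (simp only: algebra_simps power2_eq_square)
  then have "?p\<^sup>2 dvd det ?m \<longleftrightarrow> ?p\<^sup>2 dvd ?p * (c * ?m$2$1 * ?m$3$2 * ?m$4$3)"
    by (metis add.commute dvd_add_right_iff)
  also have "\<dots> \<longleftrightarrow> ?p dvd c * ?m$2$1 * ?m$3$2 * ?m$4$3"
    by (simp only: power2_eq_square padic_mult_dvd_mult)
  also have "\<dots> \<longleftrightarrow> padic_residue (c * ?m$2$1 * ?m$3$2 * ?m$4$3) = 0"
    by (rule padic_residue_eq_0_iff[symmetric])
  also have "padic_residue (c * ?m$2$1 * ?m$3$2 * ?m$4$3) = - (f_char g * alpha g * gamma g * alpha g)"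
    unfolding padic_residue_mult m by (simp add: r c)
  \<comment> \<open>The entries (2,1) and (4,3) both contribute \<open>alpha g\<close>; in a field
    the repetition does not affect vanishing.\<close>
  finally show ?thesis by (auto simp: power2_eq_square)
qed

section \<open>The chain of stable lattices\<close>

lemma coset_image_factor:
  assumes "finite (\<phi> ` A)" "\<And>x y. x \<in> A \<Longrightarrow> y \<in> A \<Longrightarrow> \<phi> x = \<phi> y \<Longrightarrow> F x = F y"
  shows "finite (F ` A)" "card (F ` A) \<le> card (\<phi> ` A)"
proof -
  have "F ` A = (F \<circ> inv_into A \<phi>) ` (\<phi> ` A)"
    unfolding image_image by (rule image_cong) (auto intro!: assms(2) simp: inv_into_into f_inv_into_f)
  then show "finite (F ` A)" "card (F ` A) \<le> card (\<phi> ` A)"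
    using assms(1) card_image_le[OF assms(1), of "F \<circ> inv_into A \<phi>"] by simp_all
qed

lemma coset_eq_iff:
  fixes L :: "'v::ab_group_add set"
  assumes "0 \<in> L" "\<And>x y. x \<in> L \<Longrightarrow> y \<in> L \<Longrightarrow> x - y \<in> L"
  shows "(+) x ` L = (+) y ` L \<longleftrightarrow> x - y \<in> L"
proof
  assume "(+) x ` L = (+) y ` L"
  then have "x + 0 \<in> (+) y ` L" using assms(1) by blast
  then show "x - y \<in> L" by auto
next
  have sub: "(+) x ` L \<subseteq> (+) y ` L" if "x - y \<in> L" for x y
  proof
    fix z assume "z \<in> (+) x ` L"
    then obtain u where u: "u \<in> L" "z = x + u" by auto
    have "(x - y) - (0 - u) \<in> L" using assms that u by blast
    moreover have "z = y + ((x - y) - (0 - u))" by (simp add: u)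
    ultimately show "z \<in> (+) y ` L" by blast
  qed
  assume *: "x - y \<in> L"
  have "0 - (x - y) \<in> L" using assms * by blast
  then have "y - x \<in> L" by simp
  with * show "(+) x ` L = (+) y ` L" using sub by blast
qed

lemma module_vec: "Modules.module ((*s) :: 'a::comm_ring_1 \<Rightarrow> 'a^'n \<Rightarrow> 'a^'n)"
  by unfold_locales (vector algebra_simps)+

lemma subspace_vec_iff:
  "module.subspace (*s) (L :: ('a::comm_ring_1^'n) set) \<longleftrightarrow>
     0 \<in> L \<and> (\<forall>x\<in>L. \<forall>y\<in>L. x + y \<in> L) \<and> (\<forall>c. \<forall>x\<in>L. c *s x \<in> L)"
  by (simp add: module.subspace_def[OF module_vec])

lemma subspace_vec_diff:
  assumes "module.subspace (*s) (L :: ('a::comm_ring_1^'n) set)" "x \<in> L" "y \<in> L"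
  shows "x - y \<in> L"
  using module.subspace_diff[OF module_vec assms] .

text \<open>
  The lattices \<open>M\<^sub>k\<close> satisfy \<open>M\<^sub>k\<^sub>+\<^sub>4 = \<ell> M\<^sub>k\<close>, and \<open>M\<^sub>k / M\<^sub>k\<^sub>+\<^sub>1\<close> for \<open>k = 0, 1, 2, 3\<close> is spanned by
  \<open>e\<^sub>1, e\<^sub>2, e\<^sub>3, e\<^sub>4\<close> respectively.
\<close>

definition filt :: "nat \<Rightarrow> ('l::prime_card padic_int ^ 4) set" where
  "filt k = {x. of_nat CARD('l) ^ ((k + 3) div 4) dvd x$1 \<and> of_nat CARD('l) ^ ((k + 2) div 4) dvd x$2 \<and>
     of_nat CARD('l) ^ ((k + 1) div 4) dvd x$3 \<and> of_nat CARD('l) ^ (k div 4) dvd x$4}"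

lemma filt_antimono: "k \<le> m \<Longrightarrow> filt m \<subseteq> filt k"
  unfolding filt_def by (auto intro: power_le_dvd[OF _ div_le_mono])

lemma subspace_filt: "module.subspace (*s) (filt k)"
  by (auto simp: subspace_vec_iff filt_def)

lemma filt_0 [simp]: "filt 0 = UNIV"
  by (auto simp: filt_def)

text \<open>Level 5 is the first with a condition modulo \<ell>^2; it is the target of the map
  induced at level 3, where \<open>f_char\<close> appears.\<close>

lemma filt_small:
  "x \<in> filt 1 \<longleftrightarrow> padic_residue (x$1) = 0"
  "x \<in> filt 2 \<longleftrightarrow> padic_residue (x$1) = 0 \<and> padic_residue (x$2) = 0"
  "x \<in> filt 3 \<longleftrightarrow> padic_residue (x$1) = 0 \<and> padic_residue (x$2) = 0 \<and> padic_residue (x$3) = 0"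
  "x \<in> filt 4 \<longleftrightarrow> padic_residue (x$1) = 0 \<and> padic_residue (x$2) = 0 \<and> padic_residue (x$3) = 0
     \<and> padic_residue (x$4) = 0"
  "(x :: 'l::prime_card padic_int ^ 4) \<in> filt 5 \<longleftrightarrow> of_nat CARD('l) * of_nat CARD('l) dvd x$1
     \<and> padic_residue (x$2) = 0 \<and> padic_residue (x$3) = 0 \<and> padic_residue (x$4) = 0"
  by (simp_all add: filt_def padic_residue_eq_0_iff power2_eq_square)

lemma filt_scale: "of_nat CARD('l) *s x \<in> filt (k + 4) \<longleftrightarrow> (x :: 'l::prime_card padic_int ^ 4) \<in> filt k"
proof -
  have "(k + 4 + 3) div 4 = Suc ((k + 3) div 4)" "(k + 4 + 2) div 4 = Suc ((k + 2) div 4)"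
    "(k + 4 + 1) div 4 = Suc ((k + 1) div 4)" "(k + 4) div 4 = Suc (k div 4)"
    by linarith+
  then show ?thesis
    by (simp add: filt_def padic_mult_dvd_mult)
qed

lemma filt_4E:
  assumes "(x :: 'l::prime_card padic_int ^ 4) \<in> filt (k + 4)"
  obtains y where "x = of_nat CARD('l) *s y" "y \<in> filt k"
proof -
  have "x \<in> filt 4" using assms filt_antimono[of 4 "k + 4"] by auto
  then have "\<forall>i. of_nat CARD('l) dvd x $ i"
    by (simp add: forall_4 filt_small padic_residue_eq_0_iff)
  from choice[OF this[unfolded dvd_def]] obtain y where "\<forall>i. x $ i = of_nat CARD('l) * y i"
    by blast
  then have "x = of_nat CARD('l) *s (\<chi> i. y i)"
    by (simp add: vec_eq_iff)
  with that show thesis using assms filt_scale by blast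
qed

text \<open>Induction suited to \<open>filt_scale\<close>: four explicit levels, then multiplication
  by \<ell>.\<close>

lemma nat_mod_4_induct [case_names 0 1 2 3 step]:
  fixes k :: nat
  assumes "P 0" "P 1" "P 2" "P 3" "\<And>k. P k \<Longrightarrow> P (k + 4)"
  shows "P k"
proof (induction k rule: less_induct)
  case (less k)
  then show ?case
  proof (cases "k < 4")
    case True
    then have "k = 0 \<or> k = 1 \<or> k = 2 \<or> k = 3" by auto
    then show ?thesis using assms by auto
  next
    case False
    then have "P (k - 4)" using less by simp
    then show ?thesis using assms(5)[of "k - 4"] False by simp
  qed
qed

text \<open>Up to sign, multiplication by this value is the map \<open>M\<^sub>k / M\<^sub>k\<^sub>+\<^sub>1 \<rightarrow> M\<^sub>k\<^sub>+\<^sub>1 / M\<^sub>k\<^sub>+\<^sub>2\<close> induced by \<open>g - 1\<close>.\<close>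

definition filt_char :: "nat \<Rightarrow> 'l::prime_card pmat \<Rightarrow> 'l mod_ring" where
  "filt_char k = (if k mod 4 = 1 then gamma else if k mod 4 = 3 then f_char else alpha)"

lemma filt_step:
  assumes g: "(g :: 'l::prime_card pmat) \<in> S_ell" and "x \<in> filt k"
  shows "g *v x - x \<in> filt (k + 1)"
    and "x \<notin> filt (k + 1) \<Longrightarrow> g *v x - x \<in> filt (k + 2) \<longleftrightarrow> filt_char k g = 0"
proof -
  note r = S_ell_residue[OF g]
  have "g *v x - x \<in> filt (k + 1) \<and>
     (x \<notin> filt (k + 1) \<longrightarrow> (g *v x - x \<in> filt (k + 2) \<longleftrightarrow> filt_char k g = 0))"
    using assms(2)
  proof (induction k arbitrary: x rule: nat_mod_4_induct)
    case 0
    then show ?case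
      by (simp add: filt_small matrix_vector_mult_nth_4 r filt_char_def
          del: One_nat_def add_2_eq_Suc')
  next
    case 1
    then show ?case
      by (simp add: filt_small matrix_vector_mult_nth_4 r filt_char_def
          del: One_nat_def add_2_eq_Suc')
  next
    case 2
    then show ?case
      by (simp add: filt_small matrix_vector_mult_nth_4 r filt_char_def)
  next
    case 3
    let ?p = "of_nat CARD('l) :: 'l padic_int"
    let ?z = "g *v x - x"
    obtain y1 y2 y3 where y: "x$1 = ?p * y1" "x$2 = ?p * y2" "x$3 = ?p * y3"
      using 3 by (auto simp: filt_small padic_residue_eq_0_iff elim!: dvdE)
    obtain c where c: "g $ 1 $ 4 = ?p * c" "f_char g = padic_residue c"
      using S_ell_f_char[OF g] .
    \<comment> \<open>After division by \<ell> only the term with \<open>c\<close> survives modulo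
      \<ell>, because the entries (1,2), (1,3) and the diagonal entry minus 1 are divisible by
      \<ell>.\<close>
    have "?z $ 1 = ?p * ((g$1$1 - 1) * y1 + g$1$2 * y2 + g$1$3 * y3 + c * x$4)"
      by (simp add: matrix_vector_mult_nth_4 y c algebra_simps)
    then have "?p * ?p dvd ?z $ 1 \<longleftrightarrow> padic_residue ((g$1$1 - 1) * y1 + g$1$2 * y2 + g$1$3 * y3 + c * x$4) = 0"
      by (simp only: padic_mult_dvd_mult padic_residue_eq_0_iff)
    then have *: "?p * ?p dvd ?z $ 1 \<longleftrightarrow> f_char g * padic_residue (x$4) = 0"
      by (simp add: r c)
    have 4: "?z \<in> filt 4"
      using 3 by (simp add: filt_small matrix_vector_mult_nth_4 r)
    have "?z \<in> filt 5 \<longleftrightarrow> f_char g * padic_residue (x$4) = 0"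
      using * 4 by (simp only: filt_small) auto
    moreover have "x \<notin> filt 4 \<longleftrightarrow> padic_residue (x$4) \<noteq> 0"
      using 3 by (simp add: filt_small)
    ultimately show ?case using 4 by (simp add: filt_char_def)
  next
    case (step k)
    obtain y where y: "x = of_nat CARD('l) *s y" "y \<in> filt k"
      using filt_4E[OF step.prems] .
    have z: "g *v x - x = of_nat CARD('l) *s (g *v y - y)"
      by (simp add: y vec_eq_iff matrix_vector_mult_nth_4 algebra_simps)
    have k: "k + 4 + 1 = (k + 1) + 4" "k + 4 + 2 = (k + 2) + 4" by simp_all
    show ?case
      unfolding z k filt_scale unfolding y(1) filt_scale
      using step.IH[OF y(2)] by (simp add: filt_char_def)
  qed
  then show "g *v x - x \<in> filt (k + 1)"
    and "x \<notin> filt (k + 1) \<Longrightarrow> g *v x - x \<in> filt (k + 2) \<longleftrightarrow> filt_char k g = 0"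
    by auto
qed

lemma padic_residue_multiple:
  assumes "padic_residue (y :: 'l::prime_card padic_int) \<noteq> 0"
  obtains a where "a < CARD('l)" "padic_residue x = of_nat a * padic_residue y"
proof -
  obtain a where a: "a < CARD('l)" "padic_residue x / padic_residue y = padic_residue (of_nat a :: 'l padic_int)"
    using padic_residue_surj by blast
  with assms have "padic_residue x = of_nat a * padic_residue y"
    by (simp add: divide_eq_eq)
  with a that show thesis by blast
qed

text \<open>Successive quotients have dimension at most one over the residue field, so any nonzero
  class spans. The bound on \<open>a\<close> is what later counts cosets.\<close>

lemma filt_quotient_generator:
  assumes "(x0 :: 'l::prime_card padic_int ^ 4) \<in> filt k" "x0 \<notin> filt (k + 1)" "x \<in> filt k"
  shows "\<exists>a<CARD('l). x - of_nat a *s x0 \<in> filt (k + 1)"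
  using assms
proof (induction k arbitrary: x x0 rule: nat_mod_4_induct)
  case 0
  then have "padic_residue (x0$1) \<noteq> 0" by (simp add: filt_small del: One_nat_def)
  from padic_residue_multiple[OF this, of "x$1"] 0 show ?case
    by (auto simp: filt_small simp del: One_nat_def)
next
  case 1
  then have "padic_residue (x0$2) \<noteq> 0" by (simp add: filt_small del: One_nat_def)
  from padic_residue_multiple[OF this, of "x$2"] 1 show ?case
    by (auto simp: filt_small simp del: One_nat_def)
next
  case 2
  then have "padic_residue (x0$3) \<noteq> 0" by (simp add: filt_small del: One_nat_def)
  from padic_residue_multiple[OF this, of "x$3"] 2 show ?case
    by (auto simp: filt_small simp del: One_nat_def)
next
  case 3
  then have "padic_residue (x0$4) \<noteq> 0" by (simp add: filt_small del: One_nat_def)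
  from padic_residue_multiple[OF this, of "x$4"] 3 show ?case
    by (auto simp: filt_small simp del: One_nat_def)
next
  case (step k)
  obtain y where y: "x = of_nat CARD('l) *s y" "y \<in> filt k"
    using filt_4E[OF step.prems(3)] .
  obtain y0 where y0: "x0 = of_nat CARD('l) *s y0" "y0 \<in> filt k"
    using filt_4E[OF step.prems(1)] .
  have k: "k + 4 + 1 = (k + 1) + 4" by simp
  have "y0 \<notin> filt (k + 1)"
    using step.prems(2) unfolding k y0 filt_scale .
  from step.IH[OF y0(2) this y(2)] obtain a
    where a: "a < CARD('l)" "y - of_nat a *s y0 \<in> filt (k + 1)" by blast
  have "x - of_nat a *s x0 = of_nat CARD('l) *s (y - of_nat a *s y0)"
    by (simp add: y y0 vec_eq_iff algebra_simps)
  with a show ?case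
    unfolding k by (metis filt_scale)
qed

text \<open>Finite index forces two multiples \<ell>^m v and \<ell>^n v with m < n into the same
  coset. Their difference is the unit 1 - \<ell>^(n-m) times \<ell>^m v.\<close>

lemma lattice4_power_smult_mem:
  assumes L: "lattice4 (L :: ('l::prime_card padic_int ^ 4) set)"
  shows "\<exists>n. of_nat CARD('l) ^ n *s v \<in> L"
proof -
  let ?p = "of_nat CARD('l) :: 'l padic_int"
  have sub: "module.subspace (*s) L" and fin: "finite (cosets_in UNIV L)"
    using L by (auto simp: lattice4_def)
  define F where "F n = (+) (?p ^ n *s v) ` L" for n
  have "range F \<subseteq> cosets_in UNIV L"
    by (auto simp: F_def cosets_in_def)
  then have "finite (range F)" using fin finite_subset by blast
  then have "\<not> inj F" using finite_imageD by blast
  then obtain m n where mn: "m < n" "F m = F n"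
    unfolding inj_def by (metis linorder_neqE_nat)
  have "?p ^ m *s v - ?p ^ n *s v \<in> L"
    using mn(2) coset_eq_iff[of L] sub subspace_vec_diff[OF sub] unfolding F_def subspace_vec_iff by blast
  moreover have "?p ^ m *s v - ?p ^ n *s v = (1 - ?p ^ (n - m)) *s (?p ^ m *s v)"
    using mn(1) by (simp add: vec_eq_iff algebra_simps flip: power_add)
  moreover obtain u where "1 = (1 - ?p ^ (n - m)) * u"
    using padic_one_minus_prime_power_unit[of "n - m"] mn(1) by (auto elim!: dvdE)
  then have "?p ^ m *s v = u *s ((1 - ?p ^ (n - m)) *s (?p ^ m *s v))"
    by (metis mult.commute vector_smult_assoc vector_smult_lid)
  ultimately show ?thesis
    using sub unfolding subspace_vec_iff by metis
qed

text \<open>One exponent \<open>N\<close> serves all four basis vectors, and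
  \<open>filt (4 * N)\<close> consists exactly of the multiples of \<ell>^N.\<close>

lemma lattice4_contains_filt:
  assumes L: "lattice4 (L :: ('l::prime_card padic_int ^ 4) set)"
  shows "\<exists>N. filt N \<subseteq> L"
proof -
  let ?p = "of_nat CARD('l) :: 'l padic_int"
  have sub: "module.subspace (*s) L" using L by (simp add: lattice4_def)
  have "\<forall>i. \<exists>n. ?p ^ n *s axis i 1 \<in> L"
    using lattice4_power_smult_mem[OF L] by blast
  from choice[OF this] obtain n where n: "\<forall>i. ?p ^ n i *s axis i 1 \<in> L" by blast
  define N where "N = n 1 + n 2 + n 3 + n 4"
  have "\<forall>i. n i \<le> N" unfolding forall_4 N_def by simp
  have N: "?p ^ N *s axis i 1 \<in> L" for i
  proof -
    have "?p ^ N = ?p ^ (N - n i) * ?p ^ n i"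
      using \<open>\<forall>i. n i \<le> N\<close> by (simp flip: power_add)
    then have "?p ^ N *s axis i 1 = ?p ^ (N - n i) *s (?p ^ n i *s axis i 1)"
      by (simp only: vector_smult_assoc)
    then show ?thesis using n sub unfolding subspace_vec_iff by simp
  qed
  have e: "(4 * N + 3) div 4 = N" "(4 * N + 2) div 4 = N" "(4 * N + 1) div 4 = N" "4 * N div 4 = N"
    by linarith+
  have "filt (4 * N) \<subseteq> L"
  proof
    fix x :: "'l padic_int ^ 4" assume "x \<in> filt (4 * N)"
    then have "\<forall>i. ?p ^ N dvd x $ i"
      by (simp only: filt_def forall_4 e mem_Collect_eq simp_thms)
    from choice[OF this[unfolded dvd_def]] obtain y where y: "\<forall>i. x $ i = ?p ^ N * y i"
      by blast
    have "x = y 1 *s (?p ^ N *s axis 1 1) + y 2 *s (?p ^ N *s axis 2 1)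
       + y 3 *s (?p ^ N *s axis 3 1) + y 4 *s (?p ^ N *s axis 4 1)"
      using y by (simp add: vec_eq_iff forall_4 axis_def algebra_simps)
    also have "\<dots> \<in> L"
      using sub N unfolding subspace_vec_iff by simp
    finally show "x \<in> L" .
  qed
  then show ?thesis by blast
qed

text \<open>Descending induction from a level already contained in \<open>L\<close>: a vector of
  level j is moved to level j + 1 by subtracting a multiple of the given element of
  \<open>L\<close>.\<close>

lemma filt_subset_if_all_levels:
  assumes L: "lattice4 (L :: ('l::prime_card padic_int ^ 4) set)"
    and lev: "\<And>j. k \<le> j \<Longrightarrow> \<exists>x\<in>L. x \<in> filt j \<and> x \<notin> filt (j + 1)"
  shows "filt k \<subseteq> L"
proof -
  have sub: "module.subspace (*s) L" using L by (simp add: lattice4_def)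
  obtain N where N: "filt N \<subseteq> L" using lattice4_contains_filt[OF L] by blast
  \<comment> \<open>Starting at the maximum also covers the case N < k.\<close>
  have "k \<le> max k N" by simp
  then show ?thesis
  proof (induction rule: inc_induct)
    case base
    show ?case using N filt_antimono[of N "max k N"] by auto
  next
    case (step j)
    obtain x0 where x0: "x0 \<in> L" "x0 \<in> filt j" "x0 \<notin> filt (j + 1)"
      using lev step.hyps by auto
    show ?case
    proof
      fix x :: "'l padic_int ^ 4" assume "x \<in> filt j"
      then obtain a where "x - of_nat a *s x0 \<in> filt (j + 1)"
        using filt_quotient_generator[OF x0(2,3)] by blast
      then have "x - of_nat a *s x0 \<in> L" using step.IH by auto
      moreover have "of_nat a *s x0 \<in> L" using x0(1) sub unfolding subspace_vec_iff by blast
      ultimately have "(x - of_nat a *s x0) + of_nat a *s x0 \<in> L"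
        using sub unfolding subspace_vec_iff by blast
      then show "x \<in> L" by simp
    qed
  qed
qed

lemma filt_zero [simp]: "0 \<in> filt k"
  using subspace_filt subspace_vec_iff by blast

lemma filt_diff: "x \<in> filt k \<Longrightarrow> y \<in> filt k \<Longrightarrow> x - y \<in> filt k"
  using subspace_vec_diff[OF subspace_filt] .

text \<open>Representatives are refined level by level, using multiples of one vector of exact level
  \<open>k\<close> whenever such a vector exists.\<close>

lemma filt_finite_representatives:
  "\<exists>R :: ('l::prime_card padic_int ^ 4) set. finite R \<and> (\<forall>x. \<exists>r\<in>R. x - r \<in> filt k)"
proof (induction k)
  case 0
  show ?case by (rule exI[of _ "{0}"]) simp
next
  case (Suc k)
  then obtain R :: "('l padic_int ^ 4) set" where R: "finite R" "\<And>x. \<exists>r\<in>R. x - r \<in> filt k"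
    by blast
  show ?case
  proof (cases "filt k \<subseteq> (filt (Suc k) :: ('l padic_int ^ 4) set)")
    case True
    with R show ?thesis by blast
  next
    case False
    then obtain x0 :: "'l padic_int ^ 4" where x0: "x0 \<in> filt k" "x0 \<notin> filt (k + 1)" by auto
    let ?R = "(\<lambda>(r, a). r + of_nat a *s x0) ` (R \<times> {..<CARD('l)})"
    have "\<exists>r\<in>?R. x - r \<in> filt (Suc k)" for x
    proof -
      obtain r where r: "r \<in> R" "x - r \<in> filt k" using R(2) by blast
      obtain a where "a < CARD('l)" "(x - r) - of_nat a *s x0 \<in> filt (k + 1)"
        using filt_quotient_generator[OF x0 r(2)] by blast
      with r(1) show ?thesis
        by (intro bexI[of _ "r + of_nat a *s x0"]) (auto simp: diff_diff_eq)
    qed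
    with R(1) show ?thesis
      by (intro exI[of _ ?R]) (simp only: finite_imageI finite_cartesian_product finite_lessThan simp_thms)
  qed
qed

lemma lattice4_filt: "lattice4 (filt k :: ('l::prime_card padic_int ^ 4) set)"
proof -
  obtain R :: "('l padic_int ^ 4) set" where R: "finite R" "\<And>x. \<exists>r\<in>R. x - r \<in> filt k"
    using filt_finite_representatives by blast
  have "cosets_in UNIV (filt k) \<subseteq> (\<lambda>r. (+) r ` filt k) ` R"
  proof
    fix C assume "C \<in> cosets_in UNIV (filt k :: ('l padic_int ^ 4) set)"
    then obtain x where x: "C = (+) x ` filt k" by (auto simp: cosets_in_def)
    obtain r where "r \<in> R" "x - r \<in> filt k" using R(2) by blast
    moreover from this(2) have "(+) x ` filt k = (+) r ` filt k"
      by (subst coset_eq_iff) (auto intro: filt_diff)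
    ultimately show "C \<in> (\<lambda>r. (+) r ` filt k) ` R"
      unfolding x by blast
  qed
  then have "finite (cosets_in UNIV (filt k :: ('l padic_int ^ 4) set))"
    by (rule finite_surj[OF R(1)])
  then show ?thesis
    unfolding lattice4_def by (intro conjI subspace_filt)
qed

lemma stable_under_filt: "(G :: 'l::prime_card pmat set) \<subseteq> S_ell \<Longrightarrow> stable_under G (filt k)"
  unfolding stable_under_def
proof (intro ballI)
  fix g :: "'l pmat" and x :: "'l padic_int ^ 4" assume "G \<subseteq> S_ell" "g \<in> G" "x \<in> filt k"
  then have "g *v x - x \<in> filt k"
    using filt_step(1)[of g x k] filt_antimono[of k "k + 1"] by auto
  then have "(g *v x - x) + x \<in> filt k"
    using \<open>x \<in> filt k\<close> subspace_filt subspace_vec_iff by blast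
  then show "g *v x \<in> filt k" by simp
qed

lemma filt_action_trivial:
  assumes "g \<in> S_ell" "filt_char k g = 0" "x \<in> filt k"
  shows "g *v x - x \<in> filt (k + 2)"
proof (cases "x \<in> filt (k + 1)")
  case True
  from filt_step(1)[OF assms(1) this] show ?thesis by (simp add: add.assoc)
next
  case False
  with filt_step(2)[OF assms(1,3)] assms(2) show ?thesis by blast
qed

text \<open>On \<open>L\<close> the map \<open>\<phi>\<close> and the coset map factor through each
  other, so \<open>coset_image_factor\<close> bounds each cardinality by the other.\<close>

lemma card_cosets_in:
  assumes "module.subspace (*s) (L' :: ('a::comm_ring_1^'n) set)" "finite (\<phi> ` L)"
    "\<And>x y. x \<in> L \<Longrightarrow> y \<in> L \<Longrightarrow> x - y \<in> L' \<longleftrightarrow> \<phi> x = \<phi> y"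
  shows "card (cosets_in L L') = card (\<phi> ` L)"
proof -
  have *: "(+) x ` L' = (+) y ` L' \<longleftrightarrow> \<phi> x = \<phi> y" if "x \<in> L" "y \<in> L" for x y
    using coset_eq_iff[of L' x y] assms(1,3) that subspace_vec_diff[OF assms(1)]
    unfolding subspace_vec_iff by blast
  show ?thesis
    unfolding cosets_in_def
    using coset_image_factor[of \<phi> L "\<lambda>x. (+) x ` L'"] coset_image_factor[of "\<lambda>x. (+) x ` L'" L \<phi>] assms(2) *
    by (simp add: le_antisym)
qed

lemma card_mod_ring_square: "card (UNIV :: ('l::prime_card mod_ring \<times> 'l mod_ring) set) = CARD('l)\<^sup>2"
  by (simp add: power2_eq_square)

lemma surj_padic_residue: "\<exists>x. padic_residue x = a"
  using padic_residue_surj[of a] by metis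

text \<open>The class of a vector is recorded by two residues, the values of \<open>\<phi>\<close>.
  Level 2 is left out because its character is \<open>alpha\<close> again, as at level 0.\<close>

lemma card_filt_quotient:
  assumes "k \<in> {0, 1, 3}"
  shows "card (cosets_in (filt k) (filt (k + 2) :: ('l::prime_card padic_int ^ 4) set)) = CARD('l)\<^sup>2"
proof -
  let ?p = "of_nat CARD('l) :: 'l padic_int"
  have main: ?thesis
    if "\<And>x y :: 'l padic_int ^ 4. x \<in> filt k \<Longrightarrow> y \<in> filt k \<Longrightarrow> x - y \<in> filt (k + 2) \<longleftrightarrow> \<phi> x = \<phi> y"
      "\<And>a b. \<exists>x \<in> filt k. \<phi> x = (a, b)" for \<phi> :: "'l padic_int ^ 4 \<Rightarrow> 'l mod_ring \<times> 'l mod_ring"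
  proof -
    have "u \<in> \<phi> ` filt k" for u
      using that(2)[of "fst u" "snd u"] by (metis imageI prod.collapse)
    then have "\<phi> ` filt k = UNIV" by blast
    moreover have "card (cosets_in (filt k) (filt (k + 2) :: ('l padic_int ^ 4) set)) = card (\<phi> ` filt k)"
      by (rule card_cosets_in[OF subspace_filt]) (use that(1) in simp_all)
    ultimately show ?thesis
      by (simp only: card_mod_ring_square)
  qed
  consider "k = 0" | "k = 1" | "k = 3" using assms by auto
  then show ?thesis
  proof cases
    case 1
    show ?thesis
    proof (rule main[of "\<lambda>x. (padic_residue (x$1), padic_residue (x$2))"])
      fix a b :: "'l mod_ring"
      obtain u v :: "'l padic_int" where "padic_residue u = a" "padic_residue v = b"
        using surj_padic_residue[of a] surj_padic_residue[of b] by blast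
      then show "\<exists>x\<in>filt k. (padic_residue (x$1), padic_residue (x$2)) = (a, b)"
        using 1 by (intro bexI[of _ "\<chi> i. if i = 1 then u else v"]) auto
    qed (use 1 in \<open>auto simp: filt_small simp del: One_nat_def add_2_eq_Suc'\<close>)
  next
    case 2
    show ?thesis
    proof (rule main[of "\<lambda>x. (padic_residue (x$2), padic_residue (x$3))"])
      fix a b :: "'l mod_ring"
      obtain u v :: "'l padic_int" where "padic_residue u = a" "padic_residue v = b"
        using surj_padic_residue[of a] surj_padic_residue[of b] by blast
      then show "\<exists>x\<in>filt k. (padic_residue (x$2), padic_residue (x$3)) = (a, b)"
        using 2 by (intro bexI[of _ "\<chi> i. if i = 1 then 0 else if i = 2 then u else v"])
          (auto simp: filt_small simp del: One_nat_def)
    qed (use 2 in \<open>auto simp: filt_small simp del: One_nat_def add_2_eq_Suc'\<close>)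
  next
    case 3
    \<comment> \<open>The quotient of \<open>filt 3\<close> by \<open>filt 5\<close> is spanned by
      e4 and \<ell> e1, so the second residue is that of the first coordinate divided by
      \<ell>.\<close>
    define q where "q x = (THE c. x = ?p * c)" for x
    have q: "q (?p * c) = c" for c
      by (simp add: q_def padic_prime_mult_cancel)
    show ?thesis
    proof (rule main[of "\<lambda>x. (padic_residue (x$4), padic_residue (q (x$1)))"])
      fix a b :: "'l mod_ring"
      obtain u v :: "'l padic_int" where "padic_residue u = a" "padic_residue v = b"
        using surj_padic_residue[of a] surj_padic_residue[of b] by blast
      then show "\<exists>x\<in>filt k. (padic_residue (x$4), padic_residue (q (x$1))) = (a, b)"
        using 3 by (intro bexI[of _ "\<chi> i. if i = 1 then ?p * v else if i = 4 then u else 0"])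
          (auto simp: filt_small q)
    next
      fix x y :: "'l padic_int ^ 4" assume xy: "x \<in> filt k" "y \<in> filt k"
      with 3 obtain c d where c: "x$1 = ?p * c" "y$1 = ?p * d"
        by (auto simp: filt_small padic_residue_eq_0_iff elim!: dvdE)
      have "x$1 - y$1 = ?p * (c - d)" by (simp add: c algebra_simps)
      then have "?p * ?p dvd x$1 - y$1 \<longleftrightarrow> padic_residue (c - d) = 0"
        by (simp only: padic_mult_dvd_mult padic_residue_eq_0_iff)
      moreover have "k + 2 = 5" using 3 by simp
      ultimately show "x - y \<in> filt (k + 2) \<longleftrightarrow>
          (padic_residue (x$4), padic_residue (q (x$1))) = (padic_residue (y$4), padic_residue (q (y$1)))"
        using xy 3 by (auto simp: filt_small c q)
    qed
  qed
qed

section \<open>Counterexamples in terms of the three characters\<close>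

lemma not_counterexample_if_trivial:
  assumes "(G :: 'l::prime_card pmat set) \<subseteq> S_ell" "k \<in> {0, 1, 3}" "\<forall>g\<in>G. filt_char k g = 0"
  shows "\<not> counterexample G"
proof -
  have "lattice4 (filt k :: ('l padic_int ^ 4) set) \<and> lattice4 (filt (k + 2) :: ('l padic_int ^ 4) set)
    \<and> stable_under G (filt k) \<and> stable_under G (filt (k + 2))
    \<and> filt (k + 2) \<subseteq> (filt k :: ('l padic_int ^ 4) set)
    \<and> card (cosets_in (filt k) (filt (k + 2) :: ('l padic_int ^ 4) set)) = CARD('l)\<^sup>2
    \<and> (\<forall>g\<in>G. \<forall>x\<in>filt k. g *v x - x \<in> filt (k + 2))"
    by (intro conjI lattice4_filt stable_under_filt[OF assms(1)] card_filt_quotient[OF assms(2)]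
        filt_antimono ballI filt_action_trivial) (use assms(1,3) in auto)
  then show ?thesis unfolding counterexample_def by blast
qed

lemma counterexample_if_nontrivial:
  assumes G: "(G :: 'l::prime_card pmat set) \<subseteq> S_ell" "G \<in> Fix_ell2"
    and ne: "\<exists>g\<in>G. alpha g \<noteq> 0" "\<exists>g\<in>G. gamma g \<noteq> 0" "\<exists>g\<in>G. f_char g \<noteq> 0"
  shows "counterexample G"
proof -
  \<comment> \<open>Every \<open>filt_char k\<close> is one of the three characters, so some element
    of \<open>G\<close> raises a vector of exact level \<open>k\<close> to exact level k +
    1.\<close>
  have raise: "\<exists>y\<in>(\<lambda>(g, x). g *v x - x) ` (G \<times> {x}). y \<in> filt (k + 1) \<and> y \<notin> filt (k + 2)"
    if "x \<in> filt k" "x \<notin> filt (k + 1)" for x k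
  proof -
    have "\<exists>g\<in>G. filt_char k g \<noteq> 0"
      using ne by (simp add: filt_char_def)
    then obtain g where "g \<in> G" "filt_char k g \<noteq> 0" by blast
    with filt_step[of g x k] that G(1) show ?thesis
      by (intro bexI[of _ "g *v x - x"]) auto
  qed
  have False
    if L: "lattice4 L" "lattice4 L'" "stable_under G L'" "L' \<subseteq> L"
      and card: "card (cosets_in L L') = CARD('l)\<^sup>2" and triv: "\<forall>g\<in>G. \<forall>x\<in>L. g *v x - x \<in> L'" for L L'
  proof -
    have sub: "module.subspace (*s) L" "module.subspace (*s) L'"
      using L by (auto simp: lattice4_def)
    obtain n where n: "of_nat CARD('l) ^ n *s axis 1 1 \<in> L"
      using lattice4_power_smult_mem[OF L(1)] by blast
    \<comment> \<open>The vector \<ell>^n e1 has exact level 4n, so \<open>L\<close> is not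
      contained in every \<open>filt k\<close> and a largest \<open>k\<close> exists.\<close>
    have "\<not> (of_nat CARD('l) ^ Suc n :: 'l padic_int) dvd of_nat CARD('l) ^ n * 1"
    proof (induction n)
      case 0
      have "padic_residue (1 :: 'l padic_int) \<noteq> 0" by simp
      then show ?case by (simp only: padic_residue_eq_0_iff) simp
    next
      case (Suc n)
      then show ?case by (simp add: padic_mult_dvd_mult mult.assoc)
    qed
    then have "\<not> of_nat CARD('l) ^ Suc n dvd (of_nat CARD('l) ^ n *s axis 1 1 :: 'l padic_int ^ 4) $ 1"
      by (simp add: axis_def)
    moreover have "(4 * n + 1 + 3) div 4 = Suc n" by linarith
    ultimately have "of_nat CARD('l) ^ n *s axis 1 1 \<notin> (filt (4 * n + 1) :: ('l padic_int ^ 4) set)"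
      unfolding filt_def by (simp only: mem_Collect_eq) blast
    with n have ex: "\<exists>k. \<not> L \<subseteq> filt (k + 1)" by blast
    define k where "k = (LEAST k. \<not> L \<subseteq> filt (k + 1))"
    have "\<not> L \<subseteq> filt (k + 1)" unfolding k_def using ex by (rule LeastI_ex)
    then obtain x where x: "x \<in> L" "x \<notin> filt (k + 1)" by blast
    have Lk: "L \<subseteq> filt k"
    proof (cases k)
      case (Suc j)
      then have "\<not> \<not> L \<subseteq> filt (j + 1)" unfolding k_def by (intro not_less_Least) simp
      then show ?thesis by (simp add: Suc)
    qed simp
    \<comment> \<open>The trivial action on L / L' brings the first vector into \<open>L'\<close>,
      at level k + 1; from there on the stability of \<open>L'\<close> keeps the raised vectors
      inside.\<close>
    have "\<exists>y\<in>L'. y \<in> filt j \<and> y \<notin> filt (j + 1)" if "k + 1 \<le> j" for j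
      using that
    proof (induction j rule: dec_induct)
      case base
      from raise[of x k] x Lk triv show ?case by (auto simp: add.assoc)
    next
      case (step j)
      then obtain y where y: "y \<in> L'" "y \<in> filt j" "y \<notin> filt (j + 1)" by blast
      obtain g where g: "g \<in> G" "g *v y - y \<in> filt (j + 1)" "g *v y - y \<notin> filt (j + 2)"
        using raise[OF y(2,3)] by auto
      have "g *v y - y \<in> L'"
        using L(3) g(1) y(1) subspace_vec_diff[OF sub(2)] unfolding stable_under_def by blast
      with g show ?case by auto
    qed
    then have L'k: "filt (k + 1) \<subseteq> L'"
      by (rule filt_subset_if_all_levels[OF L(2)])
    \<comment> \<open>Modulo \<open>filt (k + 1)\<close> all of \<open>L\<close> consists of
      multiples of \<open>x\<close>, which leaves at most \<ell> cosets.\<close>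
    have "cosets_in L L' \<subseteq> (\<lambda>a. (+) (of_nat a *s x) ` L') ` {..<CARD('l)}"
    proof
      fix C assume "C \<in> cosets_in L L'"
      then obtain y where y: "y \<in> L" "C = (+) y ` L'" by (auto simp: cosets_in_def)
      obtain a where a: "a < CARD('l)" "y - of_nat a *s x \<in> filt (k + 1)"
        using filt_quotient_generator[of x k y] x y(1) Lk by blast
      then have "C = (+) (of_nat a *s x) ` L'"
        unfolding y(2) using coset_eq_iff[of L' y "of_nat a *s x"] L'k sub(2) subspace_vec_diff[OF sub(2)]
        unfolding subspace_vec_iff by blast
      with a(1) show "C \<in> (\<lambda>a. (+) (of_nat a *s x) ` L') ` {..<CARD('l)}" by blast
    qed
    then have "card (cosets_in L L') \<le> card {..<CARD('l)}"
      by (rule surj_card_le[rotated]) simp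
    then have "CARD('l)\<^sup>2 \<le> CARD('l)" using card by simp
    then show False
      using prime_gt_1_nat[OF prime_card[where ?'a = 'l]] by (simp add: power2_eq_square)
  qed
  with G(2) show ?thesis unfolding counterexample_def by blast
qed

text \<open>From here on lattices disappear: counterexamples inside \<open>S_ell\<close> are
  recognised by the three characters alone.\<close>

lemma counterexample_iff:
  assumes "(G :: 'l::prime_card pmat set) \<subseteq> S_ell"
  shows "counterexample G \<longleftrightarrow> subgroup G (mat_group Sp4) \<and> (\<forall>g\<in>G. alpha g * gamma g * f_char g = 0)
     \<and> (\<exists>g\<in>G. alpha g \<noteq> 0) \<and> (\<exists>g\<in>G. gamma g \<noteq> 0) \<and> (\<exists>g\<in>G. f_char g \<noteq> 0)"
proof -
  have "G \<in> Fix_ell2 \<longleftrightarrow> subgroup G (mat_group Sp4) \<and> (\<forall>g\<in>G. alpha g * gamma g * f_char g = 0)"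
    unfolding Fix_ell2_def using assms det_minus_1_dvd_iff by blast
  moreover have "counterexample G \<Longrightarrow> G \<in> Fix_ell2" by (simp add: counterexample_def)
  moreover have "counterexample G \<Longrightarrow> \<exists>g\<in>G. alpha g \<noteq> 0" "counterexample G \<Longrightarrow> \<exists>g\<in>G. gamma g \<noteq> 0"
    "counterexample G \<Longrightarrow> \<exists>g\<in>G. f_char g \<noteq> 0"
    using not_counterexample_if_trivial[OF assms, of 0] not_counterexample_if_trivial[OF assms, of 1]
      not_counterexample_if_trivial[OF assms, of 3]
    by (auto simp: filt_char_def)
  ultimately show ?thesis using counterexample_if_nontrivial[OF assms] by blast
qed

section \<open>Three characters with vanishing product\<close>

text \<open>The affine functions a + t b and c + t d each vanish at no more than one of t = 0, 1, 2,
  which are distinct as 2 is nonzero. One of the three points is therefore good for both.\<close>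

lemma affine_nonzero_simultaneously:
  fixes a b c d :: "'f::field"
  assumes "(2 :: 'f) \<noteq> 0" "a \<noteq> 0 \<or> b \<noteq> 0" "c \<noteq> 0 \<or> d \<noteq> 0"
  shows "a \<noteq> 0 \<and> c \<noteq> 0 \<or> a + b \<noteq> 0 \<and> c + d \<noteq> 0 \<or> a + b + b \<noteq> 0 \<and> c + d + d \<noteq> 0"
proof -
  have "\<not> (x = 0 \<and> x + y = 0)" "\<not> (x = 0 \<and> x + y + y = 0)"
    if "x \<noteq> 0 \<or> y \<noteq> 0" for x y :: 'f
    using that assms(1) by (auto simp flip: mult_2)
  moreover have "\<not> (x + y = 0 \<and> x + y + y = 0)" if "x \<noteq> 0 \<or> y \<noteq> 0" for x y :: 'f
    using that by (metis add_0 add_0_right)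
  ultimately have *: "\<not> (x = 0 \<and> x + y = 0)" "\<not> (x = 0 \<and> x + y + y = 0)"
      "\<not> (x + y = 0 \<and> x + y + y = 0)" if "x \<noteq> 0 \<or> y \<noteq> 0" for x y :: 'f
    using that by blast+
  show ?thesis using *[OF assms(2)] *[OF assms(3)] by blast
qed

text \<open>First a vector with x and y nonzero is found; the product forces its z to vanish. Adding
  it up to twice to a vector with nonzero z keeps z and makes x and y nonzero, a
  contradiction.\<close>

lemma product_zero_imp_coordinate_zero:
  fixes V :: "('f::field \<times> 'f \<times> 'f) set"
  assumes two: "(2 :: 'f) \<noteq> 0" and add: "\<And>u v. u \<in> V \<Longrightarrow> v \<in> V \<Longrightarrow> u + v \<in> V"
    and prod: "\<And>x y z. (x, y, z) \<in> V \<Longrightarrow> x * y * z = 0"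
  shows "(\<forall>(x, y, z)\<in>V. x = 0) \<or> (\<forall>(x, y, z)\<in>V. y = 0) \<or> (\<forall>(x, y, z)\<in>V. z = 0)"
proof (rule ccontr)
  assume "\<not> ?thesis"
  then obtain x1 y1 z1 x2 y2 z2 x3 y3 z3 where
    V: "(x1, y1, z1) \<in> V" "(x2, y2, z2) \<in> V" "(x3, y3, z3) \<in> V" and ne: "x1 \<noteq> 0" "y2 \<noteq> 0" "z3 \<noteq> 0"
    by blast
  have add': "(a + a', b + b', c + c') \<in> V" if "(a, b, c) \<in> V" "(a', b', c') \<in> V" for a b c a' b' c'
    using add[OF that] by simp
  obtain x y z where p: "(x, y, z) \<in> V" "x \<noteq> 0" "y \<noteq> 0"
    using affine_nonzero_simultaneously[OF two, of x1 x2 y1 y2] ne V(1) add'[OF V(1,2)]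
      add'[OF add'[OF V(1,2)] V(2)] by blast
  then have z: "z = 0" using prod[OF p(1)] by simp
  have "\<exists>x' y'. (x', y', z3) \<in> V \<and> x' \<noteq> 0 \<and> y' \<noteq> 0"
    using affine_nonzero_simultaneously[OF two, of x3 x y3 y] p(2,3) V(3) add'[OF V(3) p(1)]
      add'[OF add'[OF V(3) p(1)] p(1)] unfolding z add_0_right by blast
  with prod ne(3) show False by fastforce
qed

text \<open>Booleans stand for the field with two elements. A subspace of its cube that lies in no
  coordinate plane and misses (1,1,1) is a plane, and the only possible one is x + y + z =
  0.\<close>

lemma bool_plane:
  fixes V :: "(bool \<times> bool \<times> bool) set"
  assumes add: "\<forall>a b c a' b' c'. (a, b, c) \<in> V \<longrightarrow> (a', b', c') \<in> V \<longrightarrow> (a \<noteq> a', b \<noteq> b', c \<noteq> c') \<in> V"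
    and "(True, True, True) \<notin> V" "\<exists>y z. (True, y, z) \<in> V" "\<exists>x z. (x, True, z) \<in> V" "\<exists>x y. (x, y, True) \<in> V"
  shows "\<forall>x y z. (x, y, z) \<in> V \<longrightarrow> z = (x \<noteq> y)"
    and "(True, False, True) \<in> V" "(False, True, True) \<in> V"
  using assms unfolding all_bool_eq ex_bool_eq simp_thms by argo+

lemma odd_character_trivial:
  assumes "CARD('l::prime_card) \<ge> 3" "(G :: 'l pmat set) \<subseteq> S_ell"
    and mult: "\<And>g h. g \<in> G \<Longrightarrow> h \<in> G \<Longrightarrow> g ** h \<in> G"
    and prod: "\<And>g. g \<in> G \<Longrightarrow> alpha g * gamma g * f_char g = 0"
  shows "(\<forall>g\<in>G. alpha g = 0) \<or> (\<forall>g\<in>G. gamma g = 0) \<or> (\<forall>g\<in>G. f_char g = 0)"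
proof -
  let ?v = "\<lambda>g. (alpha g, gamma g, f_char g)"
  have two: "(2 :: 'l mod_ring) \<noteq> 0"
  proof
    assume "(2 :: 'l mod_ring) = 0"
    then have "CARD('l) dvd 2"
      using of_nat_0_mod_ring_dvd[of 2, where 'a = 'l] by simp
    then have "CARD('l) \<le> 2" by (rule dvd_imp_le) simp
    with assms(1) show False by simp
  qed
  have "(\<forall>(x, y, z)\<in>?v ` G. x = 0) \<or> (\<forall>(x, y, z)\<in>?v ` G. y = 0) \<or> (\<forall>(x, y, z)\<in>?v ` G. z = 0)"
  proof (rule product_zero_imp_coordinate_zero[OF two, of "?v ` G"])
    fix u v assume "u \<in> ?v ` G" "v \<in> ?v ` G"
    then obtain g h where g: "g \<in> G" "h \<in> G" "u = ?v g" "v = ?v h" by blast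
    then have "g \<in> S_ell" "h \<in> S_ell" using assms(2) by auto
    with g have "u + v = ?v (g ** h)"
      by (simp add: alpha_mult gamma_mult f_char_mult)
    then show "u + v \<in> ?v ` G" using mult g(1,2) by blast
  qed (use prod in auto)
  then show ?thesis by auto
qed

section \<open>The group of reductions\<close>

text \<open>The entries (4,3) and (3,1) are forced by the symplectic relations.\<close>

definition unip :: "'a::comm_ring_1 \<Rightarrow> 'a \<Rightarrow> 'a \<Rightarrow> 'a \<Rightarrow> 'a^4^4" where
  "unip a c b d = (\<chi> i j. if i = j then 1 else if i = 2 \<and> j = 1 then a else if i = 3 \<and> j = 2 then c
     else if i = 4 \<and> j = 3 then - a else if i = 3 \<and> j = 1 then b + a * c
     else if i = 4 \<and> j = 2 then b else if i = 4 \<and> j = 1 then d else 0)"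

lemma unip_nth:
  "unip a c b d $ 1 $ 1 = 1" "unip a c b d $ 1 $ 2 = 0" "unip a c b d $ 1 $ 3 = 0" "unip a c b d $ 1 $ 4 = 0"
  "unip a c b d $ 2 $ 1 = a" "unip a c b d $ 2 $ 2 = 1" "unip a c b d $ 2 $ 3 = 0" "unip a c b d $ 2 $ 4 = 0"
  "unip a c b d $ 3 $ 1 = b + a * c" "unip a c b d $ 3 $ 2 = c" "unip a c b d $ 3 $ 3 = 1" "unip a c b d $ 3 $ 4 = 0"
  "unip a c b d $ 4 $ 1 = d" "unip a c b d $ 4 $ 2 = b" "unip a c b d $ 4 $ 3 = - a" "unip a c b d $ 4 $ 4 = 1"
  by (simp_all add: unip_def)

lemma unip_eq_iff: "unip a c b d = unip a' c' b' d' \<longleftrightarrow> a = a' \<and> c = c' \<and> b = b' \<and> d = d'"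
  by (metis unip_nth(5,10,13,14))

lemma unip_0: "unip 0 0 0 0 = mat 1"
  by (simp add: vec_eq_iff forall_4 unip_nth mat_1_nth)

lemma unip_mult:
  "unip a c b d ** unip a' c' b' d' =
     unip (a + a') (c + c') (b + b' - a * c') (d + d' + b * a' - a * (b' + a' * c'))"
  by (simp add: vec_eq_iff forall_4 unip_nth matrix_mult_nth_4 algebra_simps)

lemma unip_Sp4: "unip a c b d \<in> Sp4"
proof -
  have "invertible (unip a c b d)"
    unfolding invertible_def
    by (rule exI[of _ "unip (- a) (- c) (- b - a * c) (- d)"])
      (simp add: unip_mult algebra_simps flip: unip_0)
  then show ?thesis
    by (simp add: Sp4_def symp_form_def matrix_vector_mult_nth_4 unip_nth algebra_simps)
qed

lemma reduce_mat_unip: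
  "reduce_mat (unip a c b d) = unip (padic_residue a) (padic_residue c) (padic_residue b) (padic_residue d)"
  by (simp add: vec_eq_iff forall_4 unip_nth)

lemma unip_S_ell: "unip a c b d \<in> S_ell"
  by (simp add: S_ell_def unip_Sp4 reduce_mat_unip lower_unitriangular_def forall_4 unip_nth)

lemma reduce_mat_S_ell:
  assumes "g \<in> S_ell"
  shows "reduce_mat g = unip (alpha g) (gamma g) (padic_residue (g$4$2)) (padic_residue (g$4$1))"
  by (simp add: vec_eq_iff forall_4 unip_nth S_ell_residue[OF assms])

text \<open>Since \<open>unip\<close> makes sense over every commutative ring, a reduction is lifted
  by lifting its four parameters.\<close>

lemma reduce_mat_image_S_ell:
  "reduce_mat ` S_ell = {unip a c b d | a c b d :: 'l::prime_card mod_ring. True}"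
proof (intro equalityI subsetI)
  fix m :: "'l mod_ring^4^4" assume "m \<in> {unip a c b d | a c b d. True}"
  then obtain a c b d where m: "m = unip a c b d" by blast
  obtain a' c' b' d' :: "'l padic_int" where "padic_residue a' = a" "padic_residue c' = c"
    "padic_residue b' = b" "padic_residue d' = d"
    using surj_padic_residue[of a] surj_padic_residue[of b] surj_padic_residue[of c]
      surj_padic_residue[of d] by blast
  then have "m = reduce_mat (unip a' c' b' d')" by (simp add: m reduce_mat_unip)
  then show "m \<in> reduce_mat ` S_ell" using unip_S_ell by blast
qed (use reduce_mat_S_ell in blast)

text \<open>The symplectic transvection along e1. For c = \<ell> its reduction is trivial but
  \<open>f_char\<close> is 1, so it adjusts \<open>f_char\<close> of a lift without changing the
  reduction.\<close>

definition upper_transv :: "'a::comm_ring_1 \<Rightarrow> 'a^4^4" where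
  "upper_transv c = (\<chi> i j. if i = j then 1 else if i = 1 \<and> j = 4 then c else 0)"

lemma upper_transv_S_ell: "upper_transv (of_nat CARD('l)) \<in> (S_ell :: 'l::prime_card pmat set)"
  and reduce_mat_upper_transv: "reduce_mat (upper_transv (of_nat CARD('l)) :: 'l pmat) = mat 1"
  and f_char_upper_transv: "f_char (upper_transv (of_nat CARD('l)) :: 'l pmat) = 1"
proof -
  have "upper_transv c ** upper_transv (- c) = mat 1" for c :: "'l padic_int"
    by (simp add: vec_eq_iff forall_4 upper_transv_def matrix_mult_nth_4 mat_1_nth)
  from this this[of "- c" for c] have "invertible (upper_transv c)" for c :: "'l padic_int"
    unfolding invertible_def by (metis minus_minus)
  then have "upper_transv (of_nat CARD('l)) \<in> (Sp4 :: 'l pmat set)"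
    by (simp add: Sp4_def symp_form_def matrix_vector_mult_nth_4 upper_transv_def algebra_simps)
  moreover show r: "reduce_mat (upper_transv (of_nat CARD('l)) :: 'l pmat) = mat 1"
    by (simp add: vec_eq_iff forall_4 upper_transv_def mat_1_nth)
  ultimately show "upper_transv (of_nat CARD('l)) \<in> (S_ell :: 'l pmat set)"
    by (simp add: S_ell_def lower_unitriangular_mat_1)
  show "f_char (upper_transv (of_nat CARD('l)) :: 'l pmat) = 1"
    using f_char_eqI[of "upper_transv (of_nat CARD('l)) :: 'l pmat" 1] by (simp add: upper_transv_def)
qed

text \<open>For \<open>\<ell> = 2\<close> this is the largest counterexample inside \<open>S_ell\<close>.\<close>

definition char_plane :: "'l::prime_card pmat set" where
  "char_plane = {g \<in> S_ell. f_char g = alpha g + gamma g}"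

lemma S_ell_subset_Sp4: "S_ell \<subseteq> Sp4"
  by (auto simp: S_ell_def)

lemma subgroup_char_plane: "subgroup char_plane (mat_group Sp4)"
proof (rule subgroup_Sp4I)
  fix g h :: "'a pmat" assume g: "g \<in> char_plane" and h: "h \<in> Sp4" "g ** h = mat 1"
  then have S: "g \<in> S_ell" "h \<in> S_ell" by (auto simp: char_plane_def intro: S_ell_right_inverse)
  have "f_char g + f_char h = 0" "alpha g + alpha h = 0" "gamma g + gamma h = 0"
    using f_char_mult[OF S] alpha_mult[OF S] gamma_mult[OF S] h(2) by simp_all
  then have "f_char h = - f_char g" "alpha h = - alpha g" "gamma h = - gamma g"
    by (simp_all add: eq_neg_iff_add_eq_0 add.commute)
  then show "h \<in> char_plane" using g S by (simp add: char_plane_def)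
qed (use S_ell_subset_Sp4 in \<open>auto simp: char_plane_def S_ell_mult f_char_mult alpha_mult gamma_mult\<close>)

section \<open>The case \<open>\<ell> = 2\<close>\<close>

text \<open>
  The entries \<open>a = m\<^sub>2\<^sub>1\<close>, \<open>c = m\<^sub>3\<^sub>2\<close>, \<open>b = m\<^sub>4\<^sub>2\<close> multiply as in a Heisenberg group over the field with two
  elements, which is dihedral: the rotation exponent is \<open>c + 2 b\<close> and the reflections are the elements
  with \<open>a \<noteq> c\<close>.  The boolean arguments say that the entry is zero.
\<close>

definition dih_bool :: "bool \<Rightarrow> bool \<Rightarrow> bool \<Rightarrow> int \<times> bool" where
  "dih_bool a c b = (of_bool (\<not> c) + 2 * of_bool (\<not> b), a \<noteq> c)"

definition dih_elt :: "'a::comm_ring_1^4^4 \<Rightarrow> int \<times> bool" where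
  "dih_elt m = dih_bool (m$2$1 = 0) (m$3$2 = 0) (m$4$2 = 0)"

text \<open>With \<open>True\<close> for zero, equality is addition and disjunction is
  multiplication over the field with two elements. The arguments on the left are thus the first
  three parameters in \<open>unip_mult\<close>.\<close>

lemma dih_bool_mult:
  "dih_bool (a = a') (c = c') ((b = b') = (a \<or> c')) = dih_bool a c b \<otimes>\<^bsub>D4\<^esub> dih_bool a' c' b'"
proof -
  have "\<forall>a a' c c' b b'. dih_bool (a = a') (c = c') ((b = b') = (a \<or> c')) = dih_bool a c b \<otimes>\<^bsub>D4\<^esub> dih_bool a' c' b'"
    unfolding all_bool_eq dih_bool_def dihedral_group_def by simp
  then show ?thesis by blast
qed

text \<open>
  The entry \<open>m\<^sub>4\<^sub>1\<close> is not a character; for \<open>\<ell> = 2\<close> the summand \<open>b + a b\<close> cancels its failure to be additive.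
\<close>

definition C2_elt :: "'a::comm_ring_1^4^4 \<Rightarrow> int" where
  "C2_elt m = (if m$4$1 + m$4$2 + m$2$1 * m$4$2 = 0 then 0 else 1)"

context
  assumes card_2: "CARD('l::prime_card) = 2"
begin

section \<open>Arithmetic of the field with two elements\<close>

lemma mod_ring_2_cases: "(x :: 'l mod_ring) = 0 \<or> x = 1"
proof -
  have "{0, 1} = (UNIV :: 'l mod_ring set)"
    by (rule card_subset_eq) (simp_all add: card_2)
  then show ?thesis by blast
qed

lemma mod_ring_2_add_self: "(x :: 'l mod_ring) + x = 0"
  using of_nat_card_eq_0[where 'a = 'l] by (simp add: card_2 flip: mult_2)

lemma mod_ring_2_arith:
  fixes x y :: "'l mod_ring"
  shows "- x = x" "x - y = x + y" "(numeral (num.Bit0 n) :: 'l mod_ring) = 0"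
    "(numeral (num.Bit1 n) :: 'l mod_ring) = 1"
proof -
  show minus: "- x = x" for x :: "'l mod_ring"
    using mod_ring_2_add_self[of x] by (simp only: neg_eq_iff_add_eq_0)
  show "x - y = x + y" using minus[of y] by (metis add_uminus_conv_diff)
  show "(numeral (num.Bit0 n) :: 'l mod_ring) = 0" "(numeral (num.Bit1 n) :: 'l mod_ring) = 1"
    by (simp_all only: numeral_Bit0 numeral_Bit1 mod_ring_2_add_self add_0)
qed

lemma mod_ring_2_add_eq_0_iff: "(x :: 'l mod_ring) + y = 0 \<longleftrightarrow> (x = 0 \<longleftrightarrow> y = 0)"
  using mod_ring_2_cases[of x] mod_ring_2_cases[of y] mod_ring_2_add_self[of 1] by auto

lemma mod_ring_2_eq_iff: "(x :: 'l mod_ring) = y \<longleftrightarrow> (x = 0 \<longleftrightarrow> y = 0)"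
  using mod_ring_2_cases[of x] mod_ring_2_cases[of y] by auto

lemma mod_ring_2_add_1: "(x :: 'l mod_ring) \<noteq> y \<Longrightarrow> x + 1 = y"
  using mod_ring_2_cases[of x] mod_ring_2_cases[of y] by (auto simp: mod_ring_2_arith)

text \<open>Over the field with two elements it loses nothing to record only which characters are
  nonzero, so \<open>bool_plane\<close> applies to the image of \<open>G\<close>.\<close>

lemma even_char_plane:
  assumes G: "(G :: 'l pmat set) \<subseteq> S_ell" "counterexample G"
  shows "G \<subseteq> char_plane"
    and "\<exists>g\<in>G. alpha g = 1 \<and> gamma g = 0" "\<exists>g\<in>G. alpha g = 0 \<and> gamma g = 1"
proof -
  define v where "v g = (alpha g \<noteq> 0, gamma g \<noteq> 0, f_char g \<noteq> 0)" for g :: "'l pmat"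
  have ce: "subgroup G (mat_group Sp4)" "\<forall>g\<in>G. alpha g * gamma g * f_char g = 0"
     "\<exists>g\<in>G. alpha g \<noteq> 0" "\<exists>g\<in>G. gamma g \<noteq> 0" "\<exists>g\<in>G. f_char g \<noteq> 0"
    using G(2) unfolding counterexample_iff[OF G(1)] by auto
  have add: "\<forall>a b c a' b' c'. (a, b, c) \<in> v ` G \<longrightarrow> (a', b', c') \<in> v ` G \<longrightarrow> (a \<noteq> a', b \<noteq> b', c \<noteq> c') \<in> v ` G"
  proof (intro allI impI)
    fix a b c a' b' c' assume "(a, b, c) \<in> v ` G" "(a', b', c') \<in> v ` G"
    then obtain g h where g: "g \<in> G" "h \<in> G" "(a, b, c) = v g" "(a', b', c') = v h" by blast
    then have "g \<in> S_ell" "h \<in> S_ell" using G(1) by auto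
    with g have "(a \<noteq> a', b \<noteq> b', c \<noteq> c') = v (g ** h)"
      by (auto simp: v_def alpha_mult gamma_mult f_char_mult mod_ring_2_add_eq_0_iff)
    moreover have "g ** h \<in> G" using subgroup.m_closed[OF ce(1) g(1,2)] by simp
    ultimately show "(a \<noteq> a', b \<noteq> b', c \<noteq> c') \<in> v ` G" by blast
  qed
  have "(True, True, True) \<notin> v ` G"
    using ce(2) by (auto simp: v_def)
  moreover have "\<exists>y z. (True, y, z) \<in> v ` G" "\<exists>x z. (x, True, z) \<in> v ` G"
    "\<exists>x y. (x, y, True) \<in> v ` G"
    using ce(3-5) by (simp_all add: v_def image_iff) blast+
  ultimately have plane: "\<forall>x y z. (x, y, z) \<in> v ` G \<longrightarrow> z = (x \<noteq> y)"
      "(True, False, True) \<in> v ` G" "(False, True, True) \<in> v ` G"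
    using bool_plane[OF add] by blast+
  show "G \<subseteq> char_plane"
  proof
    fix g assume g: "g \<in> G"
    then have "v g \<in> v ` G" by blast
    with plane(1) have "(f_char g \<noteq> 0) = ((alpha g \<noteq> 0) \<noteq> (gamma g \<noteq> 0))"
      unfolding v_def by blast
    then have "f_char g = alpha g + gamma g"
      unfolding mod_ring_2_eq_iff[of "f_char g" "alpha g + gamma g"] mod_ring_2_add_eq_0_iff by blast
    with g G(1) show "g \<in> char_plane" by (auto simp: char_plane_def)
  qed
  show "\<exists>g\<in>G. alpha g = 1 \<and> gamma g = 0" "\<exists>g\<in>G. alpha g = 0 \<and> gamma g = 1"
  proof -
    obtain g h where "g \<in> G" "(True, False, True) = v g" "h \<in> G" "(False, True, True) = v h"
      using plane(2,3) by blast
    moreover from this have "alpha g = 1 \<and> gamma g = 0" "alpha h = 0 \<and> gamma h = 1"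
      using mod_ring_2_cases[of "alpha g"] mod_ring_2_cases[of "gamma h"] by (auto simp: v_def)
    ultimately show "\<exists>g\<in>G. alpha g = 1 \<and> gamma g = 0" "\<exists>g\<in>G. alpha g = 0 \<and> gamma g = 1"
      by blast+
  qed
qed

text \<open>The product x y (x + y) vanishes over the field with two elements, which settles the
  determinant condition on \<open>K\<close>; the nonzero values are inherited from
  \<open>G\<close>.\<close>

lemma counterexample_between:
  assumes G: "(G :: 'l pmat set) \<subseteq> S_ell" "counterexample G"
    and K: "subgroup K (mat_group Sp4)" "G \<subseteq> K" "K \<subseteq> char_plane"
  shows "counterexample K"
proof -
  have KS: "K \<subseteq> S_ell" using K(3) by (auto simp: char_plane_def)
  have "alpha g * gamma g * f_char g = 0" if "g \<in> K" for g
    using that K(3) mod_ring_2_cases[of "alpha g"] mod_ring_2_cases[of "gamma g"]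
      mod_ring_2_add_self[of 1]
    by (auto simp: char_plane_def)
  then show ?thesis
    using G(2) K(1,2) unfolding counterexample_iff[OF G(1)] counterexample_iff[OF KS] by blast
qed

text \<open>Inverses of reductions are cubes, so a set of reductions closed under products is closed
  under inverses.\<close>

lemma unip_pow_4:
  "unip a c b (d :: 'l mod_ring) ** (unip a c b d ** unip a c b d ** unip a c b d) = mat 1"
  by (simp add: unip_mult unip_eq_iff mod_ring_2_arith algebra_simps flip: unip_0)

text \<open>The full preimage of \<open>D\<close> in \<open>char_plane\<close> still maps onto
  \<open>D\<close>: a lift off the plane is corrected by multiplication with
  \<open>upper_transv\<close>.\<close>

lemma counterexample_lift:
  assumes D: "D \<subseteq> reduce_mat ` (S_ell :: 'l pmat set)" "mat 1 \<in> D"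
    "\<And>x y. x \<in> D \<Longrightarrow> y \<in> D \<Longrightarrow> x ** y \<in> D"
    and ne: "\<exists>m\<in>D. m$2$1 \<noteq> 0" "\<exists>m\<in>D. m$3$2 \<noteq> 0" "\<exists>m\<in>D. m$2$1 + m$3$2 \<noteq> 0"
  shows "counterexample {g \<in> char_plane. reduce_mat g \<in> D}"
    and "reduce_mat ` {g \<in> char_plane. reduce_mat g \<in> D} = D"
proof -
  let ?G = "{g \<in> char_plane. reduce_mat g \<in> D}"
  let ?t = "upper_transv (of_nat CARD('l)) :: 'l pmat"
  have S: "?G \<subseteq> S_ell" by (auto simp: char_plane_def)
  have lift: "\<exists>g\<in>?G. reduce_mat g = m" if m: "m \<in> D" for m
  proof -
    obtain g where g: "g \<in> S_ell" "m = reduce_mat g" using D(1) m by auto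
    show ?thesis
    proof (cases "f_char g = alpha g + gamma g")
      case True
      with g m show ?thesis by (auto simp: char_plane_def)
    next
      case False
      note t = upper_transv_S_ell[where 'l = 'l] reduce_mat_upper_transv[where 'l = 'l]
        f_char_upper_transv[where 'l = 'l]
      have "alpha ?t = 0" "gamma ?t = 0"
        using t(2) by (simp_all add: alpha_def gamma_def mat_1_nth del: reduce_mat_nth)
      moreover have "f_char g + 1 = alpha g + gamma g"
        using False by (rule mod_ring_2_add_1)
      ultimately have "f_char (g ** ?t) = alpha (g ** ?t) + gamma (g ** ?t)"
        unfolding f_char_mult[OF g(1) t(1)] alpha_mult[OF g(1) t(1)] gamma_mult[OF g(1) t(1)] t(3) by simp
      then show ?thesis
        using g m S_ell_mult[OF g(1) t(1)]
        by (intro bexI[of _ "g ** ?t"]) (auto simp: char_plane_def reduce_mat_mult t(2))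
    qed
  qed
  then show "reduce_mat ` ?G = D" by auto
  have "subgroup ?G (mat_group Sp4)"
  proof (rule subgroup_Sp4I)
    show "?G \<subseteq> Sp4" using S S_ell_subset_Sp4 by blast
    show "mat 1 \<in> ?G" using D(2) by (simp add: char_plane_def)
    fix g assume g: "g \<in> ?G"
    fix h
    {
      assume "h \<in> ?G"
      then show "g ** h \<in> ?G"
        using g D(3) subgroup.m_closed[OF subgroup_char_plane, of g h] by (simp add: reduce_mat_mult)
    next
      assume h: "h \<in> Sp4" "g ** h = mat 1"
      interpret group "mat_group (Sp4 :: 'l pmat set)" by (rule group_Sp4)
      have gS: "g \<in> S_ell" using g by (simp add: char_plane_def)
      have "h \<in> char_plane"
      proof -
        have "inv\<^bsub>mat_group Sp4\<^esub> g = h"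
          using inv_equality[of h g] h inv_comm[of g h] gS S_ell_subset_Sp4 by auto
        then show ?thesis using subgroup.m_inv_closed[OF subgroup_char_plane, of g] g by simp
      qed
      moreover have "reduce_mat h \<in> D"
      proof -
        let ?m = "reduce_mat g"
        have "?m ** reduce_mat h = mat 1" using h(2) by (metis reduce_mat_mult reduce_mat_1)
        moreover have "(?m ** ?m ** ?m) ** ?m = mat 1"
          using unip_pow_4 unfolding reduce_mat_S_ell[OF gS] by (simp add: matrix_mul_assoc)
        ultimately have "reduce_mat h = ?m ** ?m ** ?m"
          by (metis (no_types) matrix_mul_assoc[of "?m ** ?m ** ?m" ?m "reduce_mat h"]
              matrix_mul_lid matrix_mul_rid)
        then show ?thesis using g D(3) by simp
      qed
      ultimately show "h \<in> ?G" by simp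
    }
  qed
  moreover have "alpha g * gamma g * f_char g = 0" if "g \<in> ?G" for g
    using that mod_ring_2_cases[of "alpha g"] mod_ring_2_cases[of "gamma g"]
      mod_ring_2_add_self[of 1]
    by (auto simp: char_plane_def)
  moreover have "\<exists>g\<in>?G. alpha g \<noteq> 0" "\<exists>g\<in>?G. gamma g \<noteq> 0" "\<exists>g\<in>?G. f_char g \<noteq> 0"
  proof -
    obtain m where m: "m \<in> D" "m$2$1 \<noteq> 0" using ne(1) by blast
    then show "\<exists>g\<in>?G. alpha g \<noteq> 0" using lift[OF m(1)] unfolding alpha_def by blast
  next
    obtain m where m: "m \<in> D" "m$3$2 \<noteq> 0" using ne(2) by blast
    then show "\<exists>g\<in>?G. gamma g \<noteq> 0" using lift[OF m(1)] unfolding gamma_def by blast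
  next
    obtain m where m: "m \<in> D" "m$2$1 + m$3$2 \<noteq> 0" using ne(3) by blast
    obtain g where "g \<in> ?G" "reduce_mat g = m" using lift[OF m(1)] by blast
    moreover from this have "f_char g = m$2$1 + m$3$2" by (auto simp: char_plane_def alpha_def gamma_def)
    ultimately show "\<exists>g\<in>?G. f_char g \<noteq> 0" using m(2) by (intro bexI[of _ g]) simp_all
  qed
  ultimately show "counterexample ?G" unfolding counterexample_iff[OF S] by blast
qed

section \<open>Identification of groups of reductions with \<open>D4\<close> and
  \<open>C2 \<times>\<times> D4\<close>\<close>

lemma dih_elt_mult:
  fixes a b c d :: "'l mod_ring"
  shows "dih_elt (unip a c b d ** unip a' c' b' d') =
    dih_elt (unip a c b d) \<otimes>\<^bsub>D4\<^esub> dih_elt (unip a' c' b' d')"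
  by (simp only: dih_elt_def unip_mult unip_nth mod_ring_2_arith mod_ring_2_add_eq_0_iff mult_eq_0_iff
      dih_bool_mult)

lemma C2_elt_mult:
  fixes a b c d :: "'l mod_ring"
  shows "C2_elt (unip a c b d ** unip a' c' b' d') =
    C2_elt (unip a c b d) \<otimes>\<^bsub>C2\<^esub> C2_elt (unip a' c' b' d')"
proof -
  let ?q = "\<lambda>a b d :: 'l mod_ring. d + b + a * b"
  have "?q (a + a') (b + b' + a * c') (d + d' + b * a' + a * (b' + a' * c')) = ?q a b d + ?q a' b' d'"
    using mod_ring_2_cases[of a] by (elim disjE) (simp_all add: algebra_simps mod_ring_2_arith)
  then have *: "?q (a + a') (b + b' + a * c') (d + d' + b * a' + a * (b' + a' * c')) = 0 \<longleftrightarrow>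
      (?q a b d = 0 \<longleftrightarrow> ?q a' b' d' = 0)"
    by (simp only: mod_ring_2_add_eq_0_iff)
  show ?thesis
    unfolding C2_elt_def unip_mult unip_nth mod_ring_2_arith *
    by simp
qed

lemma dih_elt_carrier: "dih_elt (m :: 'l mod_ring^4^4) \<in> carrier D4"
  by (simp add: dih_elt_def dih_bool_def dihedral_group_def)

lemma dih_elt_eq_iff:
  "dih_elt (unip a c b d) = dih_elt (unip a' c' b' (d' :: 'l mod_ring)) \<longleftrightarrow> a = a' \<and> c = c' \<and> b = b'"
  unfolding mod_ring_2_eq_iff[of a a'] mod_ring_2_eq_iff[of b b'] mod_ring_2_eq_iff[of c c']
  by (auto simp: dih_elt_def dih_bool_def unip_nth split: if_splits)

lemma dih_elt_surj:
  assumes "u \<in> carrier D4"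
  obtains a c b :: "'l mod_ring" where "\<And>d. dih_elt (unip a c b d) = u"
proof -
  obtain k s where u: "u = (k, s)" "k \<in> {0..<4}" using assms by (auto simp: dihedral_group_def)
  then have k: "k = 0 \<or> k = 1 \<or> k = 2 \<or> k = 3" by auto
  \<comment> \<open>As k = c + 2 b, the entry \<open>c\<close> is the parity of \<open>k\<close> and
    \<open>b\<close> its upper binary digit; \<open>a\<close> differs from \<open>c\<close> exactly
    when \<open>s\<close> holds.\<close>
  have "dih_elt (unip (if s = (k = 1 \<or> k = 3) then 0 else 1) (if k = 1 \<or> k = 3 then 1 else 0)
      (if k = 2 \<or> k = 3 then 1 else 0) d :: 'l mod_ring^4^4) = u" for d
    unfolding u dih_elt_def dih_bool_def unip_nth using k by (elim disjE; cases s; simp)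
  with that show thesis by blast
qed

lemma reduce_S_ell_iso: "mat_group (reduce_mat ` (S_ell :: 'l pmat set)) \<cong> C2 \<times>\<times> D4"
proof -
  let ?S = "reduce_mat ` (S_ell :: 'l pmat set)"
  let ?h = "\<lambda>m :: 'l mod_ring^4^4. (C2_elt m, dih_elt m)"
  have "?h \<in> hom (mat_group ?S) (C2 \<times>\<times> D4)"
  proof (rule homI)
    fix x y assume "x \<in> carrier (mat_group ?S)" "y \<in> carrier (mat_group ?S)"
    then obtain a c b d a' c' b' d' where "x = unip a c b d" "y = unip a' c' b' d'"
      by (auto simp: reduce_mat_image_S_ell)
    then show "?h (x \<otimes>\<^bsub>mat_group ?S\<^esub> y) = ?h x \<otimes>\<^bsub>C2 \<times>\<times> D4\<^esub> ?h y"
      by (simp add: dih_elt_mult C2_elt_mult)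
  qed (simp add: dih_elt_carrier C2_elt_def carrier_integer_mod_group)
  moreover have "bij_betw ?h ?S (carrier (C2 \<times>\<times> D4))"
  proof (rule bij_betw_imageI)
    show "inj_on ?h ?S"
    proof (rule inj_onI)
      fix m m' assume "m \<in> ?S" "m' \<in> ?S" and eq: "?h m = ?h m'"
      then obtain a c b d a' c' b' d' where m: "m = unip a c b d" "m' = unip a' c' b' d'"
        by (auto simp: reduce_mat_image_S_ell)
      with eq have "a = a' \<and> c = c' \<and> b = b'" by (simp add: dih_elt_eq_iff)
      moreover from this have "d = 0 \<longleftrightarrow> d' = 0"
        using eq by (auto simp: m C2_elt_def unip_nth mod_ring_2_add_eq_0_iff split: if_splits)
      ultimately show "m = m'" using mod_ring_2_eq_iff[of d d'] by (simp add: m)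
    qed
    show "?h ` ?S = carrier (C2 \<times>\<times> D4)"
    proof (intro equalityI subsetI)
      fix z assume "z \<in> carrier (C2 \<times>\<times> D4)"
      then obtain e u where z: "z = (e, u)" "e \<in> {0..<2}" "u \<in> carrier D4"
        by (auto simp: carrier_integer_mod_group)
      obtain a c b :: "'l mod_ring" where "\<And>d. dih_elt (unip a c b d) = u"
        using dih_elt_surj[OF z(3)] by blast
      moreover have "e = 0 \<or> e = 1" using z(2) by auto
      \<comment> \<open>The summand b + a b in the last parameter cancels the correction in
        \<open>C2_elt\<close> and leaves \<open>e\<close>.\<close>
      then have "C2_elt (unip a c b (b + a * b + (if e = 0 then 0 else 1))) = e"
        by (auto simp: C2_elt_def unip_nth mod_ring_2_add_eq_0_iff mod_ring_2_arith)
      ultimately have "z = ?h (unip a c b (b + a * b + (if e = 0 then 0 else 1)))"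
        by (simp add: z)
      then show "z \<in> ?h ` ?S" unfolding reduce_mat_image_S_ell by blast
    qed (auto simp: dih_elt_carrier C2_elt_def carrier_integer_mod_group)
  qed
  ultimately show ?thesis unfolding is_iso_def iso_def by auto
qed

text \<open>The map \<open>dih_elt\<close> forgets the parameter \<open>d\<close>, and
  \<open>D\<close> maps onto \<open>D4\<close>. Its kernel on all reductions is generated by
  \<open>unip 0 0 0 1\<close>; whether that element lies in \<open>D\<close> separates the two
  alternatives.\<close>

lemma D4_subgroup_or_all:
  assumes D: "D \<subseteq> reduce_mat ` (S_ell :: 'l pmat set)" "mat 1 \<in> D"
    and mult: "\<And>x y. x \<in> D \<Longrightarrow> y \<in> D \<Longrightarrow> x ** y \<in> D"
    and x: "\<exists>m\<in>D. m$2$1 = 1 \<and> m$3$2 = 0" and y: "\<exists>m\<in>D. m$2$1 = 0 \<and> m$3$2 = 1"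
  shows "D = reduce_mat ` (S_ell :: 'l pmat set) \<or> mat_group D \<cong> D4"
proof -
  have Dunip: "\<exists>a c b d. m = unip a c b d" if "m \<in> D" for m
    using that D(1) unfolding reduce_mat_image_S_ell by blast
  obtain b1 d1 where x: "unip 1 0 b1 d1 \<in> D"
    using x Dunip by (metis unip_nth(5,10))
  obtain b2 d2 where y: "unip 0 1 b2 d2 \<in> D"
    using y Dunip by (metis unip_nth(5,10))
  have xy: "unip 1 1 (b1 + b2 + 1) (d1 + d2 + b2) \<in> D"
    using mult[OF x y] by (simp add: unip_mult mod_ring_2_arith)
  \<comment> \<open>The square of the product of the two generators; multiplying by it changes
    \<open>b\<close> while fixing \<open>a\<close> and \<open>c\<close>.\<close>
  have z: "unip 0 0 1 1 \<in> D"
    using mult[OF xy xy] by (simp add: unip_mult mod_ring_2_arith algebra_simps)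
  have ac: "\<exists>b d. unip a c b d \<in> D" for a c
    using mod_ring_2_cases[of a] mod_ring_2_cases[of c] x y xy D(2) unip_0[where 'a = "'l mod_ring"]
    by (elim disjE) (metis+)
  have acb: "\<exists>d. unip a c b d \<in> D" for a c b
  proof -
    obtain b' d' where m: "unip a c b' d' \<in> D" using ac by blast
    show ?thesis
    proof (cases "b' = b")
      case False
      then have "b' + 1 = b" by (rule mod_ring_2_add_1)
      with mult[OF m z] show ?thesis by (auto simp: unip_mult)
    qed (use m in blast)
  qed
  show ?thesis
  proof (cases "unip 0 0 0 1 \<in> D")
    case True
    have "unip a c b d \<in> D" for a c b d
    proof -
      obtain d' where m: "unip a c b d' \<in> D" using acb by blast
      show ?thesis
      proof (cases "d' = d")
        case False
        then have "d' + 1 = d" by (rule mod_ring_2_add_1)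
        with mult[OF m True] show ?thesis by (simp add: unip_mult)
      qed (use m in blast)
    qed
    then have "reduce_mat ` (S_ell :: 'l pmat set) \<subseteq> D"
      unfolding reduce_mat_image_S_ell by blast
    with D(1) show ?thesis by blast
  next
    case False
    have "dih_elt \<in> hom (mat_group D) D4"
    proof (rule homI)
      fix m m' assume "m \<in> carrier (mat_group D)" "m' \<in> carrier (mat_group D)"
      then obtain a c b d a' c' b' d' where "m = unip a c b d" "m' = unip a' c' b' d'"
        using Dunip by (metis mat_group_simps(1))
      then show "dih_elt (m \<otimes>\<^bsub>mat_group D\<^esub> m') = dih_elt m \<otimes>\<^bsub>D4\<^esub> dih_elt m'"
        by (simp add: dih_elt_mult)
    qed (rule dih_elt_carrier)
    moreover have "inj_on dih_elt D"
    proof (rule inj_onI)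
      fix m m' assume mD: "m \<in> D" "m' \<in> D" and eq: "dih_elt m = dih_elt m'"
      obtain a c b d a' c' b' d' where m: "m = unip a c b d" "m' = unip a' c' b' d'"
        using Dunip mD by metis
      have acb: "a' = a" "c' = c" "b' = b" using eq by (simp_all add: m dih_elt_eq_iff)
      \<comment> \<open>By \<open>unip_pow_4\<close> the left side is the inverse of
        \<open>m\<close> times \<open>m'\<close>, an element of \<open>D\<close> in the kernel of
        \<open>dih_elt\<close>.\<close>
      have "(m ** m ** m) ** m' = unip 0 0 0 (d' + d)"
      proof -
        have "m' = m ** unip 0 0 0 (d' + d)"
          by (simp add: m acb unip_mult mod_ring_2_arith algebra_simps)
        then have "(m ** m ** m) ** m' = (m ** (m ** m ** m)) ** unip 0 0 0 (d' + d)"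
          by (simp add: matrix_mul_assoc)
        then show ?thesis
          by (simp only: m unip_pow_4 matrix_mul_lid)
      qed
      then have "unip 0 0 0 (d' + d) \<in> D" using mult mD by metis
      then have "d' + d = 0" using False mod_ring_2_cases[of "d' + d"] by auto
      then show "m = m'" using mod_ring_2_eq_iff[of d d'] by (simp add: m acb mod_ring_2_add_eq_0_iff)
    qed
    moreover have "carrier D4 \<subseteq> dih_elt ` D"
    proof
      fix u assume "u \<in> carrier D4"
      then obtain a c b :: "'l mod_ring" where "\<And>d. dih_elt (unip a c b d) = u"
        using dih_elt_surj by blast
      with acb[of a c b] show "u \<in> dih_elt ` D" by (metis imageI)
    qed
    ultimately have "dih_elt \<in> iso (mat_group D) D4"
      using dih_elt_carrier unfolding iso_def bij_betw_def by auto
    then show ?thesis unfolding is_iso_def by blast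
  qed
qed

text \<open>Each of the conditions a = 0, c = 0 and a = c makes the matrices
  \<open>unip a c b d\<close> commute with one another, whereas \<open>D4\<close> is not
  commutative.\<close>

lemma D4_subgroup_characters_nontrivial:
  assumes D: "D \<subseteq> reduce_mat ` (S_ell :: 'l pmat set)" and iso: "mat_group D \<cong> D4"
  shows "\<exists>m\<in>D. m$2$1 \<noteq> 0" "\<exists>m\<in>D. m$3$2 \<noteq> 0" "\<exists>m\<in>D. m$2$1 + m$3$2 \<noteq> 0"
proof -
  obtain h where h: "h \<in> iso (mat_group D) D4" using iso unfolding is_iso_def by blast
  then have surj: "h ` D = carrier D4" and hom: "\<And>m m'. m \<in> D \<Longrightarrow> m' \<in> D \<Longrightarrow> h (m ** m') = h m \<otimes>\<^bsub>D4\<^esub> h m'"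
    by (auto simp: iso_def bij_betw_def hom_def)
  have "(1, False) \<in> h ` D" "(0, True) \<in> h ` D"
    unfolding surj by (simp_all add: dihedral_group_def)
  then obtain m m' where m: "m \<in> D" "h m = (1, False)" "m' \<in> D" "h m' = (0, True)"
    by (metis imageE)
  have "h (m ** m') \<noteq> h (m' ** m)"
    by (simp add: hom m dihedral_group_def)
  then have ne: "m ** m' \<noteq> m' ** m" by metis
  obtain a c b d a' c' b' d' where u: "m = unip a c b d" "m' = unip a' c' b' d'"
    using subsetD[OF D m(1)] subsetD[OF D m(3)] unfolding reduce_mat_image_S_ell by blast
  have entries: "m$2$1 = a" "m'$2$1 = a'" "m$3$2 = c" "m'$3$2 = c'"
    by (simp_all add: u unip_nth)
  show "\<exists>m\<in>D. m$2$1 \<noteq> 0"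
  proof (rule ccontr)
    assume "\<not> ?thesis"
    then have "a = 0" "a' = 0" using m(1,3) entries by metis+
    then show False using ne by (simp add: u unip_mult add.commute)
  qed
  show "\<exists>m\<in>D. m$3$2 \<noteq> 0"
  proof (rule ccontr)
    assume "\<not> ?thesis"
    then have "c = 0" "c' = 0" using m(1,3) entries by metis+
    then show False using ne by (simp add: u unip_mult mod_ring_2_arith algebra_simps)
  qed
  show "\<exists>m\<in>D. m$2$1 + m$3$2 \<noteq> 0"
  proof (rule ccontr)
    assume "\<not> ?thesis"
    then have "a + c = 0" "a' + c' = 0" using m(1,3) entries by metis+
    then have "c = a" "c' = a'"
      using mod_ring_2_eq_iff[of c a] mod_ring_2_eq_iff[of c' a'] by (simp_all add: mod_ring_2_add_eq_0_iff)
    \<comment> \<open>The only asymmetry left between the two products is this cubic term in the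
      last parameter.\<close>
    moreover have "a' * (a' * a) = a' * (a * a)"
      using mod_ring_2_cases[of a] mod_ring_2_cases[of a'] by auto
    then have "a' * (a' * a) + x = a' * (a * a) + x" for x by (rule arg_cong)
    ultimately show False
      using ne by (simp add: u unip_mult mod_ring_2_arith algebra_simps unip_eq_iff del: mult_cancel_left)
  qed
qed

lemma char_plane_counterexample:
  "counterexample (char_plane :: 'l pmat set)"
  "reduce_mat ` (char_plane :: 'l pmat set) = reduce_mat ` (S_ell :: 'l pmat set)"
proof -
  let ?S = "reduce_mat ` (S_ell :: 'l pmat set)"
  have "mat 1 \<in> ?S" using S_ell_one reduce_mat_1 by (metis image_eqI)
  moreover have "x ** y \<in> ?S" if "x \<in> ?S" "y \<in> ?S" for x y
    using that by (auto intro!: imageI S_ell_mult simp flip: reduce_mat_mult)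
  moreover have u: "unip a c b d \<in> ?S" for a c b d
    unfolding reduce_mat_image_S_ell by blast
  have "\<exists>m\<in>?S. m$2$1 \<noteq> 0" "\<exists>m\<in>?S. m$2$1 + m$3$2 \<noteq> 0"
    by (rule bexI[OF _ u[of 1 0 0 0]], simp add: unip_nth)+
  moreover have "\<exists>m\<in>?S. m$3$2 \<noteq> 0"
    by (rule bexI[OF _ u[of 0 1 0 0]], simp add: unip_nth)
  moreover have "char_plane = {g \<in> char_plane. reduce_mat g \<in> ?S}"
    by (auto simp: char_plane_def)
  ultimately show "counterexample (char_plane :: 'l pmat set)" "reduce_mat ` (char_plane :: 'l pmat set) = ?S"
    using counterexample_lift[of ?S] by auto
qed

text \<open>Both \<open>alpha\<close> and \<open>gamma\<close> vanish on \<open>Gamma_ell\<close>,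
  so the equation of the plane becomes f = 0 there.\<close>

lemma Gamma_ell_inter_char_plane:
  "char_plane \<inter> Gamma_ell = (Gamma_ell \<inter> ker_f :: 'l pmat set)"
proof -
  have "g \<in> S_ell \<and> alpha g = 0 \<and> gamma g = 0" if "g \<in> Gamma_ell" for g :: "'l pmat"
    using that by (auto simp: Gamma_ell_def S_ell_def lower_unitriangular_mat_1 alpha_def gamma_def mat_1_nth
        simp del: reduce_mat_nth)
  then show ?thesis by (auto simp: char_plane_def ker_f_def)
qed

text \<open>All three claims rest on G \<subseteq> \<open>char_plane\<close>. The group generated by
  \<open>G\<close> and \<open>H\<close> stays in that plane, and a maximal \<open>G\<close> must
  equal it because \<open>char_plane\<close> is itself a counterexample.\<close>

lemma even_counterexample:
  assumes G: "(G :: 'l pmat set) \<subseteq> S_ell" "counterexample G"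
  shows "(reduce_mat ` G = reduce_mat ` S_ell \<and> mat_group (reduce_mat ` (S_ell :: 'l pmat set)) \<cong> C2 \<times>\<times> D4)
     \<or> mat_group (reduce_mat ` G) \<cong> D4"
    and "subgroup H (mat_group Sp4) \<Longrightarrow> H \<subseteq> Gamma_ell \<inter> ker_f \<Longrightarrow>
     counterexample (generate (mat_group Sp4) (G \<union> H))"
    and "maximal_counterexample G \<Longrightarrow>
     mat_group (reduce_mat ` G) \<cong> D4 \<times>\<times> C2 \<and> G \<inter> Gamma_ell = Gamma_ell \<inter> ker_f"
proof -
  note plane = even_char_plane[OF G]
  have sub: "subgroup G (mat_group Sp4)" using G(2) unfolding counterexample_iff[OF G(1)] by blast
  have "reduce_mat ` G = reduce_mat ` (S_ell :: 'l pmat set) \<or> mat_group (reduce_mat ` G) \<cong> D4"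
  proof (rule D4_subgroup_or_all)
    show "reduce_mat ` G \<subseteq> reduce_mat ` (S_ell :: 'l pmat set)" using G(1) by blast
    have "mat 1 \<in> G" using subgroup.one_closed[OF sub] by simp
    then show "mat 1 \<in> reduce_mat ` G" by (metis image_eqI reduce_mat_1)
    show "x ** y \<in> reduce_mat ` G" if "x \<in> reduce_mat ` G" "y \<in> reduce_mat ` G" for x y
      using that subgroup.m_closed[OF sub] by (auto simp flip: reduce_mat_mult)
    show "\<exists>m\<in>reduce_mat ` G. m$2$1 = 1 \<and> m$3$2 = 0" "\<exists>m\<in>reduce_mat ` G. m$2$1 = 0 \<and> m$3$2 = 1"
      using plane(2,3) unfolding alpha_def gamma_def by blast+
  qed
  with reduce_S_ell_iso show "(reduce_mat ` G = reduce_mat ` S_ell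
     \<and> mat_group (reduce_mat ` (S_ell :: 'l pmat set)) \<cong> C2 \<times>\<times> D4) \<or> mat_group (reduce_mat ` G) \<cong> D4"
    by blast
  show "counterexample (generate (mat_group Sp4) (G \<union> H))"
    if H: "subgroup H (mat_group Sp4)" "H \<subseteq> Gamma_ell \<inter> ker_f"
  proof (rule counterexample_between[OF G])
    have GH: "G \<union> H \<subseteq> char_plane" using plane(1) H(2) Gamma_ell_inter_char_plane by blast
    moreover have "char_plane \<subseteq> (Sp4 :: 'l pmat set)"
      using S_ell_subset_Sp4 by (auto simp: char_plane_def)
    ultimately show "subgroup (generate (mat_group Sp4) (G \<union> H)) (mat_group Sp4)"
      by (intro group.generate_is_subgroup[OF group_Sp4]) auto
    show "G \<subseteq> generate (mat_group Sp4) (G \<union> H)"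
      by (auto intro: generate.incl)
    show "generate (mat_group Sp4) (G \<union> H) \<subseteq> char_plane"
      by (rule group.generate_subgroup_incl[OF group_Sp4 GH subgroup_char_plane])
  qed
  show "mat_group (reduce_mat ` G) \<cong> D4 \<times>\<times> C2 \<and> G \<inter> Gamma_ell = Gamma_ell \<inter> ker_f"
    if "maximal_counterexample G"
  proof -
    have "G = char_plane"
      using that plane(1) char_plane_counterexample(1) unfolding maximal_counterexample_def by blast
    moreover have "C2 \<times>\<times> D4 \<cong> D4 \<times>\<times> C2" by (rule DirProd_commute_iso)
    ultimately show ?thesis
      using char_plane_counterexample(2) reduce_S_ell_iso Gamma_ell_inter_char_plane iso_trans by metis
  qed
qed

end



theorem theorem3p1:
  shows "(CARD('l::prime_card) \<ge> 3 \<longrightarrow>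
      (\<forall>G :: ('l padic_int ^ 4 ^ 4) set. G \<subseteq> S_ell \<longrightarrow> G \<in> Fix_ell2 \<longrightarrow>
         ((\<forall>g\<in>G. alpha g = 0) \<or> (\<forall>g\<in>G. gamma g = 0) \<or> (\<forall>g\<in>G. f_char g = 0)) \<and>
         \<not> counterexample G))
    \<and> (CARD('l) = 2 \<longrightarrow>
      (\<forall>G :: ('l padic_int ^ 4 ^ 4) set. G \<subseteq> S_ell \<longrightarrow> counterexample G \<longrightarrow>
         ((reduce_mat ` G = reduce_mat ` S_ell \<and> mat_group (reduce_mat ` (S_ell :: ('l padic_int ^ 4 ^ 4) set)) \<cong> C2 \<times>\<times> D4)
            \<or> mat_group (reduce_mat ` G) \<cong> D4)
         \<and> (\<forall>H. subgroup H (mat_group Sp4) \<longrightarrow> H \<subseteq> Gamma_ell \<inter> ker_f \<longrightarrow>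
              counterexample (generate (mat_group Sp4) (G \<union> H)))
         \<and> (maximal_counterexample G \<longrightarrow>
              mat_group (reduce_mat ` G) \<cong> D4 \<times>\<times> C2 \<and> G \<inter> Gamma_ell = Gamma_ell \<inter> ker_f))
      \<and> (\<exists>G :: ('l padic_int ^ 4 ^ 4) set. G \<subseteq> S_ell \<and> counterexample G \<and>
           reduce_mat ` G = reduce_mat ` S_ell)
      \<and> (\<forall>D. subgroup D (mat_group (reduce_mat ` (S_ell :: ('l padic_int ^ 4 ^ 4) set))) \<longrightarrow>
           mat_group D \<cong> D4 \<longrightarrow>
           (\<exists>G :: ('l padic_int ^ 4 ^ 4) set. G \<subseteq> S_ell \<and> counterexample G \<and> reduce_mat ` G = D)))"
proof (intro conjI impI allI)
  assume large: "CARD('l) \<ge> 3"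
  fix G :: "'l pmat set" assume G: "G \<subseteq> S_ell" "G \<in> Fix_ell2"
  have sub: "subgroup G (mat_group Sp4)" using G(2) by (simp add: Fix_ell2_def)
  have "alpha g * gamma g * f_char g = 0" if "g \<in> G" for g
    using that G det_minus_1_dvd_iff[of g] by (auto simp: Fix_ell2_def)
  then show trivial: "(\<forall>g\<in>G. alpha g = 0) \<or> (\<forall>g\<in>G. gamma g = 0) \<or> (\<forall>g\<in>G. f_char g = 0)"
    using odd_character_trivial[OF large G(1)] subgroup.m_closed[OF sub] by simp
  then show "\<not> counterexample G" unfolding counterexample_iff[OF G(1)] by blast
next
  assume two: "CARD('l) = 2"
  {
    fix G :: "'l pmat set" assume G: "G \<subseteq> S_ell" "counterexample G"
    show "(reduce_mat ` G = reduce_mat ` S_ell \<and> mat_group (reduce_mat ` (S_ell :: 'l pmat set)) \<cong> C2 \<times>\<times> D4)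
       \<or> mat_group (reduce_mat ` G) \<cong> D4"
      by (rule even_counterexample(1)[OF two G])
    show "counterexample (generate (mat_group Sp4) (G \<union> H))"
      if "subgroup H (mat_group Sp4)" "H \<subseteq> Gamma_ell \<inter> ker_f" for H
      by (rule even_counterexample(2)[OF two G that])
    assume max: "maximal_counterexample G"
    show "mat_group (reduce_mat ` G) \<cong> D4 \<times>\<times> C2"
      using even_counterexample(3)[OF two G max] by blast
    show "G \<inter> Gamma_ell = Gamma_ell \<inter> ker_f"
      using even_counterexample(3)[OF two G max] by blast
  next
    have "char_plane \<subseteq> (S_ell :: 'l pmat set)" by (auto simp: char_plane_def)
    then show "\<exists>G :: 'l pmat set. G \<subseteq> S_ell \<and> counterexample G \<and> reduce_mat ` G = reduce_mat ` S_ell"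
      using char_plane_counterexample[OF two] by blast
  next
    fix D assume D: "subgroup D (mat_group (reduce_mat ` (S_ell :: 'l pmat set)))" "mat_group D \<cong> D4"
    \<comment> \<open>The full preimage of \<open>D\<close> in \<open>char_plane\<close> is the
      lift; the isomorphism with \<open>D4\<close> guarantees that no character vanishes on
      it.\<close>
    let ?G = "{g \<in> char_plane. reduce_mat g \<in> D}"
    have sub: "D \<subseteq> reduce_mat ` (S_ell :: 'l pmat set)" using subgroup.subset[OF D(1)] by simp
    have "mat 1 \<in> D" "\<And>x y. x \<in> D \<Longrightarrow> y \<in> D \<Longrightarrow> x ** y \<in> D"
      using subgroup.one_closed[OF D(1)] subgroup.m_closed[OF D(1)] by simp_all
    then have "counterexample ?G" "reduce_mat ` ?G = D"
      using counterexample_lift[OF two sub] D4_subgroup_characters_nontrivial[OF two sub D(2)] by blast+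
    moreover have "?G \<subseteq> S_ell" by (auto simp: char_plane_def)
    ultimately show "\<exists>G :: 'l pmat set. G \<subseteq> S_ell \<and> counterexample G \<and> reduce_mat ` G = D"
      by blast
  }
qed

end
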